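(* Let $A\in\mathbb R^{n\times n}$ be symmetric positive definite, let $N$, $n_s$, $R_s$, $\tilde A_s$ ($s=1,\dots,N$) satisfy the local setting and let $V_0$, $R_0$ satisfy the coarse setting (both described in the context). Assume moreover that all local operators $\tilde A_s$, $s\in\{1,\dots,N\}$, are non-singular. Let $H_{ad}$ be the two-level additive preconditioner, $N^c$ a coloring constant, $C_\sharp$ a constant as defined in the context, and let $\tau,\upsilon>0$. In the following, $\lambda(B)$ denotes an arbitrary eigenvalue of $B$. 1. (Natural bound for $\lambda_{\max}$) $$\lambda(H_{ad}A)\le N^cC_\sharp^{-1}+1.$$ 2. (GenEO for $\lambda_{\min}$) Suppose the splitting assumption of the context (or its partition-of-unity version) holds with spsd matrices $M_s$ and constant $\hat N_c>0$. Suppose that for every $s\in\{1,\dots,N\}$ at least one of the following holds: (a) $R_s^\top\mathcal Y_L(\tau^{-1},M_s,\tilde A_s)\subset V_0$; (b) $M_s$ is non-singular and $R_s^\top\mathcal Y_H(\tau,\tilde A_s,M_s)\subset V_0$; (c) $W_s\in\mathbb R^{n_s\times\operatorname{rank}(M_s)}$ is a matrix whose columns form an $\ell_2$-orthonormal basis of $\operatorname{range}(M_s)$ and $R_s^\top\left[\operatorname{Ker}(M_s)+W_s\,\mathcal Y_H(\tau,W_s^\top\tilde A_sW_s,W_s^\top M_sW_s)\right]\subset V_0$. Then $$\left[\max\left(2,1+2N^cC_\sharp^{-1}\right)\max(1,\hat N_c\tau)\right]^{-1}\le\lambda(H_{ad}A).$$ 3. (Double GenEO for $\lambda_{\min}$)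 Suppose the splitting assumption of the context (or its partition-of-unity version) holds with spsd matrices $M_s$ and constant $\hat N_c>0$. Suppose that for every $s\in\{1,\dots,N\}$, $R_s^\top\mathcal Y_L(\upsilon,\tilde A_s,R_sAR_s^\top)\subset V_0$ and, in addition, at least one of the conditions (a), (b), (c) listed in item 2 holds. Then $$\left[\max\left(2,1+2N^c\upsilon^{-1}\right)\max(1,\hat N_c\tau)\right]^{-1}\le\lambda(H_{ad}A).$$
   Context: Abbreviations: spd = symmetric positive definite, spsd = symmetric positive semi-definite. $B^\dagger$ is the Moore-Penrose pseudo-inverse. $\langle x,y\rangle=x^\top y$; for an spd matrix $B$, $\|x\|_B=\langle x,Bx\rangle^{1/2}$; for an spsd matrix $B$, $|x|_B=\langle x,Bx\rangle^{1/2}$ (a semi-norm). Local setting: $N\in\mathbb N$ is the number of subdomains, and for each $s\in\{1,\dots,N\}$, $n_s\in\mathbb N$, $R_s\in\mathbb R^{n_s\times n}$ and $\tilde A_s\in\mathbb R^{n_s\times n_s}$ are such that: $R_sR_s^\top=I$; $\mathbb R^n=\sum_{s=1}^N\operatorname{range}(R_s^\top)$; each $\tilde A_s$ is spsd; and the one-level preconditioner $H:=\sum_{s=1}^NR_s^\top\tilde A_s^\dagger R_s$ is non-singular (hence spd). Coarse setting: $V_0\subset\mathbb R^n$ is a subspace (the coarse space) and $R_0\in\mathbb R^{\dim(V_0)\times n}$ is a matrix whose rows form a basis of $V_0$, so $V_0=\operatorname{range}(R_0^\top)$. Two-level additive preconditioner: $H_{ad}:=H+R_0^\top(R_0AR_0^\top)^{-1}R_0$.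 Coloring constant: $N^c\in\mathbb N$ is such that there are subsets $\mathcal C_1,\dots,\mathcal C_{N^c}$ of $\{1,\dots,N\}$ with $\{1,\dots,N\}=\bigcup_{j}\mathcal C_j$ and, for each $j$ and all $s,t\in\mathcal C_j$ with $s\ne t$, $R_sAR_t^\top=0$. Splitting assumption: there are spsd matrices $M_s\in\mathbb R^{n_s\times n_s}$ ($s=1,\dots,N$) and a real $\hat N_c>0$ such that every $x\in\mathbb R^n$ can be written $x=\sum_{s=1}^NR_s^\top y_s$ with $y_s\in\mathbb R^{n_s}$ and $\sum_{s=1}^N\langle y_s,M_sy_s\rangle\le\hat N_c\langle x,Ax\rangle$. Partition-of-unity version (which implies the splitting assumption with $y_s=D_sR_sx$): there are spd matrices $D_s\in\mathbb R^{n_s\times n_s}$ with $I=\sum_{s=1}^NR_s^\top D_sR_s$, spsd matrices $M_s$, and $\hat N_c>0$ with $\sum_{s=1}^N\langle D_sR_sx,M_sD_sR_sx\rangle\le\hat N_c\langle x,Ax\rangle$ for every $x\in\mathbb R^n$. Spaces $\mathcal Y_L,\mathcal Y_H$: for $M_A\in\mathbb R^{m\times m}$ spsd, $M_B\in\mathbb R^{m\times m}$ spd and a scalar $\tau>0$, $\mathcal Y_L(\tau,M_A,M_B):=\operatorname{span}\{y: M_Ay=\lambda M_By\text{ with }\lambda<\tau\}$ and $\mathcal Y_H(\tau,M_A,M_B):=\operatorname{span}\{y: M_Ay=\lambda M_By\text{ with }\lambda\ge\tau\}$. Constant $C_\sharp$: $C_\sharp>0$ is such that for every $s=1,\dots,N$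 and every $x_s\in\mathbb R^{n_s}$, $\|\tilde\Pi_sR_s^\top x_s\|_A^2\le C_\sharp^{-1}|x_s|_{\tilde A_s}^2$, where $\tilde\Pi_s$ is the $A$-orthogonal projection with $\operatorname{Ker}(\tilde\Pi_s)=R_s^\top\operatorname{Ker}(\tilde A_s)$ (the identity when $\tilde A_s$ is non-singular, as assumed in this theorem). *)

theory Defs
  imports
    Complex_Main
    "Jordan_Normal_Form.Matrix_Kernel"
    "Jordan_Normal_Form.Gauss_Jordan_Elimination"
    "Jordan_Normal_Form.Char_Poly"
    "Jordan_Normal_Form.DL_Rank"
begin

definition spsd :: "nat \<Rightarrow> real mat \<Rightarrow> bool" where
  "spsd m B \<longleftrightarrow> B \<in> carrier_mat m m \<and> B\<^sup>T = B \<and> (\<forall>x\<in>carrier_vec m. 0 \<le> x \<bullet> (B *\<^sub>v x))"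

definition spd :: "nat \<Rightarrow> real mat \<Rightarrow> bool" where
  "spd m B \<longleftrightarrow> B \<in> carrier_mat m m \<and> B\<^sup>T = B \<and>
     (\<forall>x\<in>carrier_vec m. x \<noteq> 0\<^sub>v m \<longrightarrow> 0 < x \<bullet> (B *\<^sub>v x))"

text \<open>The norm induced by an spd matrix, and the semi-norm induced by an spsd one.\<close>

definition energy_norm :: "real mat \<Rightarrow> real vec \<Rightarrow> real" where
  "energy_norm B x = sqrt (x \<bullet> (B *\<^sub>v x))"

definition sum_mats :: "nat \<Rightarrow> nat \<Rightarrow> (nat \<Rightarrow> real mat) \<Rightarrow> nat set \<Rightarrow> real mat" where
  "sum_mats nr nc F I = mat nr nc (\<lambda>(i, j). \<Sum>s\<in>I. F s $$ (i, j))"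

definition is_moore_penrose :: "real mat \<Rightarrow> real mat \<Rightarrow> bool" where
  "is_moore_penrose B X \<longleftrightarrow> X \<in> carrier_mat (dim_col B) (dim_row B) \<and>
     B * X * B = B \<and> X * B * X = X \<and> (B * X)\<^sup>T = B * X \<and> (X * B)\<^sup>T = X * B"

definition pinv :: "real mat \<Rightarrow> real mat" where
  "pinv B = (THE X. is_moore_penrose B X)"

definition mat_range :: "real mat \<Rightarrow> real vec set" where
  "mat_range B = (*\<^sub>v) B ` carrier_vec (dim_col B)"

abbreviation subspace_vs :: "nat \<Rightarrow> real vec set \<Rightarrow> (real, real vec) module" where
  "subspace_vs m W \<equiv> module_vec TYPE(real) m\<lparr>carrier := W\<rparr>"

definition one_level :: "nat \<Rightarrow> nat \<Rightarrow> (nat \<Rightarrow> real mat) \<Rightarrow> (nat \<Rightarrow> real mat) \<Rightarrow> real mat" where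
  "one_level n N R At = sum_mats n n (\<lambda>s. (R s)\<^sup>T * pinv (At s) * R s) {1..N}"

definition local_setting ::
  "nat \<Rightarrow> nat \<Rightarrow> (nat \<Rightarrow> nat) \<Rightarrow> (nat \<Rightarrow> real mat) \<Rightarrow> (nat \<Rightarrow> real mat) \<Rightarrow> bool" where
  "local_setting n N ns R At \<longleftrightarrow>
     (\<forall>s\<in>{1..N}. R s \<in> carrier_mat (ns s) n \<and> R s * (R s)\<^sup>T = 1\<^sub>m (ns s) \<and> spsd (ns s) (At s)) \<and>
     carrier_vec n =
       {finsum_vec TYPE(real) n v {1..N} | v. \<forall>s\<in>{1..N}. v s \<in> mat_range ((R s)\<^sup>T)} \<and>
     invertible_mat (one_level n N R At)"

text \<open>The number of rows of \<open>R0\<close> is the dimension of \<open>V0\<close>, so that if its set of rows is a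
  basis, then the rows are also pairwise distinct.\<close>

definition coarse_setting :: "nat \<Rightarrow> real vec set \<Rightarrow> real mat \<Rightarrow> bool" where
  "coarse_setting n V0 R0 \<longleftrightarrow>
     VectorSpace.subspace class_ring V0 (module_vec TYPE(real) n) \<and>
     R0 \<in> carrier_mat (vectorspace.dim class_ring (subspace_vs n V0)) n \<and>
     vectorspace.basis class_ring (subspace_vs n V0) (set (rows R0))"

definition two_level_additive ::
  "nat \<Rightarrow> nat \<Rightarrow> (nat \<Rightarrow> real mat) \<Rightarrow> (nat \<Rightarrow> real mat) \<Rightarrow> real mat \<Rightarrow> real mat \<Rightarrow> real mat" where
  "two_level_additive n N R At A R0 =
     one_level n N R At + R0\<^sup>T * the (mat_inverse (R0 * A * R0\<^sup>T)) * R0"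

definition coloring_constant ::
  "nat \<Rightarrow> (nat \<Rightarrow> nat) \<Rightarrow> (nat \<Rightarrow> real mat) \<Rightarrow> real mat \<Rightarrow> nat \<Rightarrow> bool" where
  "coloring_constant N ns R A Nc \<longleftrightarrow>
     (\<exists>C :: nat \<Rightarrow> nat set.
        (\<forall>j\<in>{1..Nc}. C j \<subseteq> {1..N}) \<and> {1..N} = (\<Union>j\<in>{1..Nc}. C j) \<and>
        (\<forall>j\<in>{1..Nc}. \<forall>s\<in>C j. \<forall>t\<in>C j. s \<noteq> t \<longrightarrow> R s * A * (R t)\<^sup>T = 0\<^sub>m (ns s) (ns t)))"

definition is_orth_projection :: "nat \<Rightarrow> real mat \<Rightarrow> real vec set \<Rightarrow> real mat \<Rightarrow> bool" where
  "is_orth_projection n A K P \<longleftrightarrow> P \<in> carrier_mat n n \<and> P * P = P \<and> mat_kernel P = K \<and>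
     (\<forall>x\<in>mat_range P. \<forall>y\<in>mat_kernel P. x \<bullet> (A *\<^sub>v y) = 0)"

text \<open>The \<open>A\<close>-orthogonal projection with kernel \<open>K\<close>.\<close>

definition orth_projection :: "nat \<Rightarrow> real mat \<Rightarrow> real vec set \<Rightarrow> real mat" where
  "orth_projection n A K = (THE P. is_orth_projection n A K P)"

definition sharp_constant ::
  "nat \<Rightarrow> nat \<Rightarrow> (nat \<Rightarrow> nat) \<Rightarrow> (nat \<Rightarrow> real mat) \<Rightarrow> (nat \<Rightarrow> real mat) \<Rightarrow> real mat \<Rightarrow> real \<Rightarrow> bool" where
  "sharp_constant n N ns R At A C \<longleftrightarrow> 0 < C \<and>
     (\<forall>s\<in>{1..N}. \<forall>x\<in>carrier_vec (ns s).
        (energy_norm A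
          (orth_projection n A ((*\<^sub>v) ((R s)\<^sup>T) ` mat_kernel (At s)) *\<^sub>v ((R s)\<^sup>T *\<^sub>v x)))\<^sup>2
        \<le> inverse C * (energy_norm (At s) x)\<^sup>2)"

definition splitting ::
  "nat \<Rightarrow> nat \<Rightarrow> (nat \<Rightarrow> nat) \<Rightarrow> (nat \<Rightarrow> real mat) \<Rightarrow> real mat \<Rightarrow> (nat \<Rightarrow> real mat) \<Rightarrow> real \<Rightarrow> bool" where
  "splitting n N ns R A M Nhat \<longleftrightarrow> (\<forall>s\<in>{1..N}. spsd (ns s) (M s)) \<and> 0 < Nhat \<and>
     (\<forall>x\<in>carrier_vec n. \<exists>y. (\<forall>s\<in>{1..N}. y s \<in> carrier_vec (ns s)) \<and>
        x = finsum_vec TYPE(real) n (\<lambda>s. (R s)\<^sup>T *\<^sub>v y s) {1..N} \<and>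
        (\<Sum>s=1..N. y s \<bullet> (M s *\<^sub>v y s)) \<le> Nhat * (x \<bullet> (A *\<^sub>v x)))"

definition pou_splitting ::
  "nat \<Rightarrow> nat \<Rightarrow> (nat \<Rightarrow> nat) \<Rightarrow> (nat \<Rightarrow> real mat) \<Rightarrow> real mat \<Rightarrow> (nat \<Rightarrow> real mat) \<Rightarrow> real \<Rightarrow> bool" where
  "pou_splitting n N ns R A M Nhat \<longleftrightarrow> (\<forall>s\<in>{1..N}. spsd (ns s) (M s)) \<and> 0 < Nhat \<and>
     (\<exists>D. (\<forall>s\<in>{1..N}. spd (ns s) (D s)) \<and>
        1\<^sub>m n = sum_mats n n (\<lambda>s. (R s)\<^sup>T * D s * R s) {1..N} \<and>
        (\<forall>x\<in>carrier_vec n.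
           (\<Sum>s=1..N. (D s *\<^sub>v (R s *\<^sub>v x)) \<bullet> (M s *\<^sub>v (D s *\<^sub>v (R s *\<^sub>v x))))
             \<le> Nhat * (x \<bullet> (A *\<^sub>v x))))"

definition YL :: "nat \<Rightarrow> real \<Rightarrow> real mat \<Rightarrow> real mat \<Rightarrow> real vec set" where
  "YL m \<tau> MA MB = LinearCombinations.module.span class_ring (module_vec TYPE(real) m)
     {y \<in> carrier_vec m. \<exists>\<mu>. MA *\<^sub>v y = \<mu> \<cdot>\<^sub>v (MB *\<^sub>v y) \<and> \<mu> < \<tau>}"

definition YH :: "nat \<Rightarrow> real \<Rightarrow> real mat \<Rightarrow> real mat \<Rightarrow> real vec set" where
  "YH m \<tau> MA MB = LinearCombinations.module.span class_ring (module_vec TYPE(real) m)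
     {y \<in> carrier_vec m. \<exists>\<mu>. MA *\<^sub>v y = \<mu> \<cdot>\<^sub>v (MB *\<^sub>v y) \<and> \<mu> \<ge> \<tau>}"

definition orthonormal_basis_cols :: "nat \<Rightarrow> real vec set \<Rightarrow> real mat \<Rightarrow> bool" where
  "orthonormal_basis_cols m V W \<longleftrightarrow>
     vectorspace.basis class_ring (subspace_vs m V) (set (cols W)) \<and>
     (\<forall>i<dim_col W. \<forall>j<dim_col W. col W i \<bullet> col W j = (if i = j then 1 else 0))"

text \<open>Three alternative requirements on a single subdomain, with \<open>m\<close> local unknowns; the coarse space
  has to contain the images of the generalized eigenvectors at the bad end of the spectrum of the
  pencil of \<open>Ats\<close> and \<open>Ms\<close>. The third one allows for singular \<open>Ms\<close>: the pencil is compressed to the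
  range of \<open>Ms\<close>, and the kernel of \<open>Ms\<close> goes into the coarse space.\<close>

definition geneo_a :: "nat \<Rightarrow> real vec set \<Rightarrow> real \<Rightarrow> real mat \<Rightarrow> real mat \<Rightarrow> real mat \<Rightarrow> bool" where
  "geneo_a m V0 \<tau> Rs Ats Ms \<longleftrightarrow> (*\<^sub>v) (Rs\<^sup>T) ` YL m (inverse \<tau>) Ms Ats \<subseteq> V0"

definition geneo_b :: "nat \<Rightarrow> real vec set \<Rightarrow> real \<Rightarrow> real mat \<Rightarrow> real mat \<Rightarrow> real mat \<Rightarrow> bool" where
  "geneo_b m V0 \<tau> Rs Ats Ms \<longleftrightarrow>
     invertible_mat Ms \<and> (*\<^sub>v) (Rs\<^sup>T) ` YH m \<tau> Ats Ms \<subseteq> V0"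

definition geneo_c :: "nat \<Rightarrow> real vec set \<Rightarrow> real \<Rightarrow> real mat \<Rightarrow> real mat \<Rightarrow> real mat \<Rightarrow> bool" where
  "geneo_c m V0 \<tau> Rs Ats Ms \<longleftrightarrow>
     (\<exists>W \<in> carrier_mat m (vec_space.rank m Ms).
        orthonormal_basis_cols m (mat_range Ms) W \<and>
        (*\<^sub>v) (Rs\<^sup>T) ` {u + W *\<^sub>v w | u w. u \<in> mat_kernel Ms \<and>
            w \<in> YH (vec_space.rank m Ms) \<tau> (W\<^sup>T * Ats * W) (W\<^sup>T * Ms * W)} \<subseteq> V0)"

definition geneo_condition ::
  "nat \<Rightarrow> real vec set \<Rightarrow> real \<Rightarrow> real mat \<Rightarrow> real mat \<Rightarrow> real mat \<Rightarrow> bool" where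
  "geneo_condition m V0 \<tau> Rs Ats Ms \<longleftrightarrow>
     geneo_a m V0 \<tau> Rs Ats Ms \<or> geneo_b m V0 \<tau> Rs Ats Ms \<or> geneo_c m V0 \<tau> Rs Ats Ms"

end

theory Submission
  imports Defs "Jordan_Normal_Form.Schur_Decomposition"
begin

text \<open>Let \<open>H\<close> be the two-level operator. If \<open>H A x = \<lambda> x\<close>, then \<open>\<lambda> \<parallel>x\<parallel>\<^sub>A\<^sup>2\<close> is the sum of the local
  energies of the solutions \<open>z\<^sub>s\<close> of \<open>A\<^sub>s z\<^sub>s = R\<^sub>s A x\<close> and of the energy of the \<open>A\<close>-orthogonal projection of
  \<open>x\<close> onto the coarse space. Gluing local vectors costs at most a factor \<open>N\<^sup>c C\<^sup>-\<^sup>1\<close> in energy: vectors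
  of equal color are \<open>A\<close>-orthogonal, and colors are combined by Cauchy-Schwarz. This bounds \<open>\<lambda>\<close>
  from above.

  For the lower bound it suffices to decompose \<open>x\<close> stably into a coarse vector and local vectors.
  The component of \<open>x\<close> that is \<open>A\<close>-orthogonal to the coarse space is split into local vectors, and each
  of these is decomposed along the generalized eigenvectors of its pencil. The bad part lies in the
  coarse space, the good part has local energy at most \<open>\<tau>\<close> times its \<open>M\<^sub>s\<close>-energy. For double GenEO
  the good part is decomposed once more, along the pencil of \<open>A\<^sub>s\<close> and \<open>R\<^sub>s A R\<^sub>s\<^sup>T\<close>, which makes
  \<open>\<upsilon>\<close> replace \<open>C\<close>.

  The pencil of a symmetric \<open>A\<close> and an spd \<open>B\<close> is handled through \<open>T = B\<^sup>-\<^sup>1 A\<close>: its eigenvalues are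
  real, so \<open>T\<close> is triangularizable over the reals, and \<open>(T - e)\<^sup>2 y = 0\<close> implies \<open>(T - e) y = 0\<close> because
  \<open>T\<close> is self-adjoint for \<open>B\<close>. Climbing the invariant flag shows that every vector is a sum of
  generalized eigenvectors.\<close>

section \<open>Sums of vectors and bilinear forms\<close>

abbreviation vsum :: "nat \<Rightarrow> ('a \<Rightarrow> real vec) \<Rightarrow> 'a set \<Rightarrow> real vec" where
  "vsum n f I \<equiv> finsum_vec TYPE(real) n f I"

lemma vsum_closed:
  assumes "\<And>i. i \<in> I \<Longrightarrow> f i \<in> carrier_vec n"
  shows "vsum n f I \<in> carrier_vec n"
  using assms by (intro finsum_vec_closed) auto

lemma vsum_index:
  assumes "finite I" "j < n" "\<And>i. i \<in> I \<Longrightarrow> f i \<in> carrier_vec n"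
  shows "vsum n f I $ j = (\<Sum>i\<in>I. f i $ j)"
  using assms by (intro index_finsum_vec) auto

lemma vsum_empty: "vsum n f {} = 0\<^sub>v n"
  by (rule finsum_vec_empty)

lemma vsum_insert:
  assumes "finite I" "i \<notin> I" "\<And>k. k \<in> insert i I \<Longrightarrow> f k \<in> carrier_vec n"
  shows "vsum n f (insert i I) = f i + vsum n f I"
  using assms by (intro finsum_vec_insert) auto

lemma vsum_cong:
  assumes "finite I" "\<And>i. i \<in> I \<Longrightarrow> f i = g i" "\<And>i. i \<in> I \<Longrightarrow> g i \<in> carrier_vec n"
  shows "vsum n f I = vsum n g I"
  using assms by (intro eq_vecI) (auto simp: vsum_index vsum_closed carrier_vecD[OF vsum_closed])

lemma vsum_add:
  assumes "finite I" "\<And>i. i \<in> I \<Longrightarrow> f i \<in> carrier_vec n" "\<And>i. i \<in> I \<Longrightarrow> g i \<in> carrier_vec n"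
  shows "vsum n (\<lambda>i. f i + g i) I = vsum n f I + vsum n g I"
proof (rule eq_vecI)
  have "vsum n (\<lambda>i. f i + g i) I \<in> carrier_vec n" "vsum n f I \<in> carrier_vec n"
    "vsum n g I \<in> carrier_vec n" using assms by (auto intro!: vsum_closed)
  then show "dim_vec (vsum n (\<lambda>i. f i + g i) I) = dim_vec (vsum n f I + vsum n g I)" by auto
  fix j assume "j < dim_vec (vsum n f I + vsum n g I)"
  then have j: "j < n" using \<open>vsum n g I \<in> carrier_vec n\<close> by auto
  have "(\<Sum>i\<in>I. (f i + g i) $ j) = (\<Sum>i\<in>I. f i $ j + g i $ j)"
    using assms(3) j by (intro sum.cong refl index_add_vec(1)) (metis carrier_vecD)
  then show "vsum n (\<lambda>i. f i + g i) I $ j = (vsum n f I + vsum n g I) $ j"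
    using j assms \<open>vsum n g I \<in> carrier_vec n\<close> by (simp add: vsum_index sum.distrib)
qed

lemma vsum_Un_disjoint:
  assumes "finite I" "finite J" "I \<inter> J = {}" "\<And>i. i \<in> I \<union> J \<Longrightarrow> f i \<in> carrier_vec n"
  shows "vsum n f (I \<union> J) = vsum n f I + vsum n f J"
proof (rule eq_vecI)
  have "vsum n f (I \<union> J) \<in> carrier_vec n" "vsum n f I \<in> carrier_vec n"
    and c: "vsum n f J \<in> carrier_vec n" using assms by (auto intro!: vsum_closed)
  then show "dim_vec (vsum n f (I \<union> J)) = dim_vec (vsum n f I + vsum n f J)" by auto
  fix j assume "j < dim_vec (vsum n f I + vsum n f J)"
  then have "j < n" using c by auto
  moreover from this have "vsum n f (I \<union> J) $ j = (\<Sum>i\<in>I \<union> J. f i $ j)"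
    using assms by (intro vsum_index) auto
  ultimately show "vsum n f (I \<union> J) $ j = (vsum n f I + vsum n f J) $ j"
    using assms c by (simp add: vsum_index sum.union_disjoint)
qed

lemma scalar_prod_vsum:
  assumes "finite I" "\<And>i. i \<in> I \<Longrightarrow> f i \<in> carrier_vec n" "x \<in> carrier_vec n"
  shows "x \<bullet> vsum n f I = (\<Sum>i\<in>I. x \<bullet> f i)"
  using assms
proof (induction I rule: finite_induct)
  case (insert i I)
  have "vsum n f I \<in> carrier_vec n" using insert.prems by (auto intro: vsum_closed)
  with insert show ?case
    by (subst vsum_insert) (auto simp: scalar_prod_add_distrib[of x n])
qed (simp add: vsum_empty)

lemma mult_mat_vec_vsum:
  assumes "finite I" "\<And>i. i \<in> I \<Longrightarrow> f i \<in> carrier_vec n" "M \<in> carrier_mat m n"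
  shows "M *\<^sub>v vsum n f I = vsum m (\<lambda>i. M *\<^sub>v f i) I"
  using assms
proof (induction I rule: finite_induct)
  case empty
  then show ?case by (intro eq_vecI) (auto simp: vsum_empty)
next
  case (insert i I)
  have "vsum n f I \<in> carrier_vec n" using insert.prems by (auto intro: vsum_closed)
  moreover have "vsum n f (insert i I) = f i + vsum n f I"
    by (rule vsum_insert) (use insert in auto)
  moreover have "vsum m (\<lambda>i. M *\<^sub>v f i) (insert i I) = M *\<^sub>v f i + vsum m (\<lambda>i. M *\<^sub>v f i) I"
    by (rule vsum_insert) (use insert in auto)
  ultimately show ?case
    using insert by (auto simp: mult_add_distrib_mat_vec[of M m n])
qed

text \<open>Reduces membership of a finite sum in a set to closure under addition; applied to spans
  and to the coarse space.\<close>

lemma vsum_induct [consumes 2, case_names zero add]: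
  assumes "finite I" "\<And>i. i \<in> I \<Longrightarrow> f i \<in> carrier_vec n \<and> Q (f i)"
    and "Q (0\<^sub>v n)" "\<And>u v. u \<in> carrier_vec n \<Longrightarrow> v \<in> carrier_vec n \<Longrightarrow> Q u \<Longrightarrow> Q v \<Longrightarrow> Q (u + v)"
  shows "Q (vsum n f I)"
  using assms(1,2)
proof (induction I rule: finite_induct)
  case empty
  then show ?case using assms(3) by (simp add: vsum_empty)
next
  case (insert i I)
  have c: "vsum n f I \<in> carrier_vec n" using insert.prems by (auto intro: vsum_closed)
  have "vsum n f (insert i I) = f i + vsum n f I"
    by (rule vsum_insert) (use insert in auto)
  then show ?case using assms(4)[OF _ c] insert by auto
qed

text \<open>The matrix may be rectangular, so that the two arguments may have different lengths.
  This lets \<open>bil_transpose\<close> move a matrix of basis columns across a product.\<close>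

definition bil :: "real mat \<Rightarrow> real vec \<Rightarrow> real vec \<Rightarrow> real" where
  "bil M x y = x \<bullet> (M *\<^sub>v y)"

lemma bil_add_left:
  assumes "M \<in> carrier_mat n m" "x \<in> carrier_vec n" "x' \<in> carrier_vec n" "y \<in> carrier_vec m"
  shows "bil M (x + x') y = bil M x y + bil M x' y"
  using assms unfolding bil_def by (auto simp: add_scalar_prod_distrib[of x n])

lemma bil_add_right:
  assumes "M \<in> carrier_mat n m" "x \<in> carrier_vec n" "y \<in> carrier_vec m" "y' \<in> carrier_vec m"
  shows "bil M x (y + y') = bil M x y + bil M x y'"
  using assms unfolding bil_def
  by (auto simp: mult_add_distrib_mat_vec[of M n m] scalar_prod_add_distrib[of x n])

lemma bil_diff_left:
  assumes "M \<in> carrier_mat n m" "x \<in> carrier_vec n" "x' \<in> carrier_vec n" "y \<in> carrier_vec m"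
  shows "bil M (x - x') y = bil M x y - bil M x' y"
  using assms unfolding bil_def by (auto simp: minus_scalar_prod_distrib[of x n])

lemma bil_diff_right:
  assumes "M \<in> carrier_mat n m" "x \<in> carrier_vec n" "y \<in> carrier_vec m" "y' \<in> carrier_vec m"
  shows "bil M x (y - y') = bil M x y - bil M x y'"
  using assms unfolding bil_def
  by (auto simp: mult_minus_distrib_mat_vec[of M n m] scalar_prod_minus_distrib[of x n])

lemma bil_smult_left:
  assumes "M \<in> carrier_mat n m" "x \<in> carrier_vec n" "y \<in> carrier_vec m"
  shows "bil M (c \<cdot>\<^sub>v x) y = c * bil M x y"
  using assms unfolding bil_def by auto

lemma bil_smult_right:
  assumes "M \<in> carrier_mat n m" "x \<in> carrier_vec n" "y \<in> carrier_vec m"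
  shows "bil M x (c \<cdot>\<^sub>v y) = c * bil M x y"
  using assms unfolding bil_def by (auto simp: mult_mat_vec[of M n m])

lemma bil_transpose:
  assumes "M \<in> carrier_mat n m" "x \<in> carrier_vec n" "y \<in> carrier_vec m"
  shows "bil M x y = bil M\<^sup>T y x"
  using transpose_vec_mult_scalar[of M n m y x] assms
    comm_scalar_prod[of y m "M\<^sup>T *\<^sub>v x"] unfolding bil_def by auto

section \<open>Spectral decomposition of symmetric definite pencils\<close>

lemma spdD:
  assumes "spd m B"
  shows "B \<in> carrier_mat m m" "B\<^sup>T = B"
    "\<And>x. x \<in> carrier_vec m \<Longrightarrow> x \<noteq> 0\<^sub>v m \<Longrightarrow> 0 < bil B x x"
    "\<And>x. x \<in> carrier_vec m \<Longrightarrow> 0 \<le> bil B x x"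
    "\<And>x. x \<in> carrier_vec m \<Longrightarrow> bil B x x \<le> 0 \<Longrightarrow> x = 0\<^sub>v m"
proof -
  show c: "B \<in> carrier_mat m m" "B\<^sup>T = B" using assms unfolding spd_def by auto
  show pos: "0 < bil B x x" if "x \<in> carrier_vec m" "x \<noteq> 0\<^sub>v m" for x
    using assms that unfolding spd_def bil_def by auto
  show "0 \<le> bil B x x" if "x \<in> carrier_vec m" for x
    using pos[OF that] c(1) by (cases "x = 0\<^sub>v m") (simp_all add: bil_def less_imp_le)
  show "x = 0\<^sub>v m" if "x \<in> carrier_vec m" "bil B x x \<le> 0" for x
    using pos[of x] that by linarith
qed

lemma bil_sym:
  assumes "B \<in> carrier_mat m m" "B\<^sup>T = B" "x \<in> carrier_vec m" "y \<in> carrier_vec m"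
  shows "bil B x y = bil B y x"
  using bil_transpose[OF assms(1,3,4)] assms(2) by simp

text \<open>Over a field a zero kernel forces a nonzero determinant, which makes \<open>B\<close> a
  unit of the matrix ring, so Gauss-Jordan elimination succeeds. The value of
  \<open>mat_inverse\<close> is kept because the coarse solver is written with it.\<close>

lemma trivial_kernel_obtain_inverse:
  fixes B :: "real mat"
  assumes "B \<in> carrier_mat m m" "\<And>v. v \<in> carrier_vec m \<Longrightarrow> B *\<^sub>v v = 0\<^sub>v m \<Longrightarrow> v = 0\<^sub>v m"
  obtains X where "X \<in> carrier_mat m m" "B * X = 1\<^sub>m m" "X * B = 1\<^sub>m m" "mat_inverse B = Some X"
proof -
  have "det B \<noteq> 0"
    unfolding det_0_iff_vec_prod_zero_field[OF assms(1)] using assms(2) by blast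
  then have "B \<in> Units (ring_mat TYPE(real) m ())" by (rule det_non_zero_imp_unit[OF assms(1)])
  with mat_inverse(1)[OF assms(1), where b = "()"] obtain X where X: "mat_inverse B = Some X"
    by (cases "mat_inverse B") simp_all
  from mat_inverse(2)[OF assms(1) X] show ?thesis using X by (intro that[of X]) simp_all
qed

lemma spd_obtain_inverse:
  assumes "spd m B"
  obtains X where "X \<in> carrier_mat m m" "B * X = 1\<^sub>m m" "X * B = 1\<^sub>m m" "mat_inverse B = Some X"
proof (rule trivial_kernel_obtain_inverse[OF spdD(1)[OF assms]])
  fix v assume v: "v \<in> carrier_vec m" "B *\<^sub>v v = 0\<^sub>v m"
  then have "bil B v v = 0" unfolding bil_def by auto
  then show "v = 0\<^sub>v m" using spdD(5)[OF assms v(1)] by simp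
qed

text \<open>Write a complex eigenvector as \<open>p + i q\<close>. Expressing
  \<open>bil A q p\<close> and \<open>bil A p q\<close> through \<open>B\<close> and subtracting,
  symmetry cancels everything except \<open>Im z * (bil B p p + bil B q q)\<close>, and the second
  factor is positive. Only real forms are involved.\<close>

lemma pencil_eigenvalue_real:
  assumes A: "A \<in> carrier_mat m m" "A\<^sup>T = A" and B: "spd m B"
    and T: "T \<in> carrier_mat m m" "B * T = A"
    and ev: "eigenvalue (map_mat complex_of_real T) z"
  shows "Im z = 0"
proof -
  note B1 = spdD(1)[OF B]
  have BT: "bil B x (T *\<^sub>v y) = bil A x y" if "x \<in> carrier_vec m" "y \<in> carrier_vec m" for x y
    using that B1 T(1) unfolding bil_def T(2)[symmetric] by simp
  obtain v where v: "v \<in> carrier_vec m" "v \<noteq> 0\<^sub>v m" "map_mat complex_of_real T *\<^sub>v v = z \<cdot>\<^sub>v v"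
    using ev T unfolding eigenvalue_def eigenvector_def by auto
  define p where "p = map_vec Re v"
  define q where "q = map_vec Im v"
  have pq: "p \<in> carrier_vec m" "q \<in> carrier_vec m" using v unfolding p_def q_def by auto
  \<comment> \<open>Row \<open>i\<close> of the eigenvector equation. As \<open>T\<close> has real
    entries, its real and imaginary parts are the rows of \<open>Tp\<close> and
    \<open>Tq\<close>.\<close>
  have *: "(\<Sum>j\<in>{0..<m}. of_real (T $$ (i, j)) * v $ j) = z * v $ i" if "i < m" for i
    using arg_cong[OF v(3), of "\<lambda>w. w $ i"] that T v(1) by (auto simp: scalar_prod_def)
  have Tp: "T *\<^sub>v p = Re z \<cdot>\<^sub>v p - Im z \<cdot>\<^sub>v q"
  proof (rule eq_vecI)
    fix i assume "i < dim_vec (Re z \<cdot>\<^sub>v p - Im z \<cdot>\<^sub>v q)"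
    then have i: "i < m" using pq by auto
    have "(T *\<^sub>v p) $ i = (\<Sum>j\<in>{0..<m}. T $$ (i, j) * Re (v $ j))"
      using i T v(1) by (auto simp: scalar_prod_def p_def)
    also have "\<dots> = Re (z * v $ i)" unfolding *[OF i, symmetric] by simp
    also have "\<dots> = (Re z \<cdot>\<^sub>v p - Im z \<cdot>\<^sub>v q) $ i" using i v(1) by (auto simp: p_def q_def)
    finally show "(T *\<^sub>v p) $ i = (Re z \<cdot>\<^sub>v p - Im z \<cdot>\<^sub>v q) $ i" .
  qed (use T pq in auto)
  have Tq: "T *\<^sub>v q = Re z \<cdot>\<^sub>v q + Im z \<cdot>\<^sub>v p"
  proof (rule eq_vecI)
    fix i assume "i < dim_vec (Re z \<cdot>\<^sub>v q + Im z \<cdot>\<^sub>v p)"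
    then have i: "i < m" using pq by auto
    have "(T *\<^sub>v q) $ i = (\<Sum>j\<in>{0..<m}. T $$ (i, j) * Im (v $ j))"
      using i T v(1) by (auto simp: scalar_prod_def q_def)
    also have "\<dots> = Im (z * v $ i)" unfolding *[OF i, symmetric] by simp
    also have "\<dots> = (Re z \<cdot>\<^sub>v q + Im z \<cdot>\<^sub>v p) $ i" using i v(1) by (auto simp: p_def q_def)
    finally show "(T *\<^sub>v q) $ i = (Re z \<cdot>\<^sub>v q + Im z \<cdot>\<^sub>v p) $ i" .
  qed (use T pq in auto)
  have 1: "bil A q p = Re z * bil B q p - Im z * bil B q q"
    using B1 pq by (simp add: BT[OF pq(2,1), symmetric] Tp bil_diff_right[of B m m] bil_smult_right[of B m m])
  have 2: "bil A p q = Re z * bil B p q + Im z * bil B p p"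
    using B1 pq by (simp add: BT[OF pq(1,2), symmetric] Tq bil_add_right[of B m m] bil_smult_right[of B m m])
  have "Im z * (bil B p p + bil B q q) = 0"
    using 1 2 bil_sym[OF A pq] bil_sym[OF B1 spdD(2)[OF B] pq] by (simp add: algebra_simps)
  moreover have "bil B p p + bil B q q \<noteq> 0"
  proof
    assume "bil B p p + bil B q q = 0"
    then have "bil B p p \<le> 0" "bil B q q \<le> 0"
      using spdD(4)[OF B pq(1)] spdD(4)[OF B pq(2)] by auto
    then have "p = 0\<^sub>v m" "q = 0\<^sub>v m" using spdD(5)[OF B] pq by auto
    then have "Re (v $ i) = 0" "Im (v $ i) = 0" if "i < m" for i
      using that v(1) unfolding p_def q_def
      by (metis carrier_vecD index_map_vec(1) index_zero_vec(1))+
    then have "v = 0\<^sub>v m" using v(1) by (intro eq_vecI) (auto simp: complex_eq_iff)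
    then show False using v(2) by simp
  qed
  ultimately show ?thesis by simp
qed

text \<open>Over the complex numbers the polynomial splits, and its roots are real. The real parts
  of the roots therefore give the same product, and the embedding of real polynomials into complex
  ones is injective.\<close>

lemma pencil_char_poly_splits:
  assumes A: "A \<in> carrier_mat m m" "A\<^sup>T = A" and B: "spd m B"
    and T: "T \<in> carrier_mat m m" "B * T = A"
  obtains es where "char_poly T = (\<Prod>e\<leftarrow>es. [:- e, 1:])"
proof -
  let ?T = "map_mat complex_of_real T"
  interpret c: map_poly_inj_comm_ring_hom complex_of_real ..
  have cT: "?T \<in> carrier_mat m m" using T by auto
  obtain zs where zs: "char_poly ?T = (\<Prod>a\<leftarrow>zs. [:- a, 1:])"
    using char_poly_factorized[OF cT] by blast
  have real: "of_real (Re a) = a" if "a \<in> set zs" for a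
  proof -
    have "poly (char_poly ?T) a = 0" using that unfolding zs poly_prod_list by (simp add: prod_list_zero_iff image_iff)
    then have "eigenvalue ?T a" unfolding eigenvalue_root_char_poly[OF cT] .
    then have "Im a = 0" by (rule pencil_eigenvalue_real[OF A B T])
    then show ?thesis by (simp add: complex_eq_iff)
  qed
  have "map_poly complex_of_real (\<Prod>e\<leftarrow>map Re zs. [:- e, 1:]) = (\<Prod>a\<leftarrow>zs. [:- a, 1:])"
    using real
  proof (induction zs)
    case (Cons a zs)
    have "map_poly complex_of_real [:- Re a, 1:] = [:- a, 1:]" using Cons.prems[OF list.set_intros(1)] by simp
    moreover have "map_poly complex_of_real (\<Prod>e\<leftarrow>map Re zs. [:- e, 1:]) = (\<Prod>a\<leftarrow>zs. [:- a, 1:])"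
      by (rule Cons.IH) (rule Cons.prems, simp)
    ultimately show ?case by (simp only: list.map prod_list.Cons c.hom_mult)
  qed simp
  moreover have "char_poly ?T = map_poly complex_of_real (char_poly T)"
    by (rule of_real_hom.char_poly_hom[OF T(1)])
  ultimately have "map_poly complex_of_real (char_poly T) =
      map_poly complex_of_real (\<Prod>e\<leftarrow>map Re zs. [:- e, 1:])"
    using zs by (metis (no_types))
  from c.injectivity[OF this] have "char_poly T = (\<Prod>e\<leftarrow>map Re zs. [:- e, 1:])" .
  then show ?thesis by (rule that)
qed

text \<open>Consequently \<open>U - U $$ (k, k)\<close> sends a vector supported on indices up to
  \<open>k\<close> to one supported strictly below \<open>k\<close>: one step down the invariant
  flag.\<close>

lemma mult_upper_triangular_vec:
  fixes U :: "real mat"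
  assumes U: "U \<in> carrier_mat m m" "upper_triangular U" and c: "c \<in> carrier_vec m"
    and k: "k < m" and supp: "\<And>i. i < m \<Longrightarrow> k < i \<Longrightarrow> c $ i = 0"
    and i: "i < m" "k \<le> i"
  shows "(U *\<^sub>v c) $ i = U $$ (k, k) * c $ i"
proof -
  have "(U *\<^sub>v c) $ i = (\<Sum>j\<in>{0..<m}. U $$ (i, j) * c $ j)"
    using i U(1) c by (auto simp: scalar_prod_def)
  \<comment> \<open>Terms with \<open>j < k\<close> vanish because then \<open>j < i\<close> and
    \<open>U\<close> is upper triangular, those with \<open>k < j\<close> because \<open>c\<close>
    vanishes there. For \<open>k < i\<close> the remaining value is zero on both sides.\<close>
  also have "\<dots> = (\<Sum>j\<in>{0..<m}. if j = k then U $$ (k, k) * c $ i else 0)"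
  proof (rule sum.cong[OF refl])
    fix j assume j: "j \<in> {0..<m}"
    show "U $$ (i, j) * c $ j = (if j = k then U $$ (k, k) * c $ i else 0)"
    proof (cases "j = k")
      case True
      then show ?thesis using i supp[OF i(1)] U k unfolding upper_triangular_def by (cases "i = k") auto
    next
      case False
      then have "j < k \<or> k < j" by auto
      then show ?thesis using i j supp[of j] U unfolding upper_triangular_def by auto
    qed
  qed
  finally show ?thesis using k by simp
qed

text \<open>The eigenvalues themselves index the summands, so different summands belong to different
  eigenvalues. A summand may be zero, hence an index need not be a true eigenvalue.\<close>

definition pencil_expansion :: "nat \<Rightarrow> real mat \<Rightarrow> real mat \<Rightarrow> real vec \<Rightarrow> real set \<Rightarrow> (real \<Rightarrow> real vec) \<Rightarrow> bool" where
  "pencil_expansion m A B y I f \<longleftrightarrow> finite I \<and> y = vsum m f I \<and>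
     (\<forall>\<mu>\<in>I. f \<mu> \<in> carrier_vec m \<and> A *\<^sub>v f \<mu> = \<mu> \<cdot>\<^sub>v (B *\<^sub>v f \<mu>))"

text \<open>On a summand for \<mu> different from \<open>e\<close>, the map \<open>T - e\<close> is
  multiplication by \<open>\<mu> - e\<close> and can be inverted. Subtracting these preimages from
  \<open>y\<close> leaves \<open>y'\<close> with \<open>(T - e) y' = z\<close>, where
  \<open>z\<close> is the summand for \<open>e\<close>. Once \<open>z\<close> is known to vanish,
  \<open>y'\<close> is the new summand for \<open>e\<close>.\<close>

lemma pencil_expansion_step:
  assumes A: "A \<in> carrier_mat m m" "A\<^sup>T = A" and B: "spd m B"
    and T: "T \<in> carrier_mat m m" "B * T = A"
    and y: "y \<in> carrier_vec m"
    and ex: "pencil_expansion m A B (T *\<^sub>v y - e \<cdot>\<^sub>v y) I f"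
  shows "\<exists>J g. pencil_expansion m A B y J g"
proof -
  note B1 = spdD(1)[OF B] and Bs = spdD(2)[OF B]
  have fin: "finite I" and sm: "T *\<^sub>v y - e \<cdot>\<^sub>v y = vsum m f I"
    and fc: "\<And>\<mu>. \<mu> \<in> I \<Longrightarrow> f \<mu> \<in> carrier_vec m"
    and fe: "\<And>\<mu>. \<mu> \<in> I \<Longrightarrow> A *\<^sub>v f \<mu> = \<mu> \<cdot>\<^sub>v (B *\<^sub>v f \<mu>)"
    using ex unfolding pencil_expansion_def by auto
  have BT: "B *\<^sub>v (T *\<^sub>v x) = A *\<^sub>v x" if "x \<in> carrier_vec m" for x
    using that B1 T(1) unfolding T(2)[symmetric] by simp
  obtain X where X: "X \<in> carrier_mat m m" "X * B = 1\<^sub>m m" using spd_obtain_inverse[OF B] by metis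
  have XB: "X *\<^sub>v (B *\<^sub>v x) = x" if "x \<in> carrier_vec m" for x
    using that X B1 by (metis assoc_mult_mat_vec one_mult_mat_vec)
  have Tf: "T *\<^sub>v f \<mu> = \<mu> \<cdot>\<^sub>v f \<mu>" if "\<mu> \<in> I" for \<mu>
  proof -
    have "T *\<^sub>v f \<mu> = X *\<^sub>v (A *\<^sub>v f \<mu>)"
      using XB[of "T *\<^sub>v f \<mu>"] BT[OF fc[OF that]] T(1) fc[OF that] by simp
    also have "\<dots> = \<mu> \<cdot>\<^sub>v (X *\<^sub>v (B *\<^sub>v f \<mu>))"
      unfolding fe[OF that] using X(1) B1 fc[OF that] by (intro mult_mat_vec[of X m m]) auto
    finally show ?thesis using XB[OF fc[OF that]] by simp
  qed
  define S where "S = T - e \<cdot>\<^sub>m 1\<^sub>m m"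
  have Sc: "S \<in> carrier_mat m m" using T unfolding S_def by auto
  have S: "S *\<^sub>v x = T *\<^sub>v x - e \<cdot>\<^sub>v x" if "x \<in> carrier_vec m" for x
    unfolding S_def using that T(1)
    by (subst minus_mult_distrib_mat_vec[of _ m m]) (auto intro!: eq_vecI)
  define J where "J = I - {e}"
  define g where "g = (\<lambda>\<mu>. inverse (\<mu> - e) \<cdot>\<^sub>v f \<mu>)"
  define w where "w = vsum m g J"
  have gc: "g \<mu> \<in> carrier_vec m" if "\<mu> \<in> J" for \<mu> using fc that unfolding g_def J_def by auto
  have wc: "w \<in> carrier_vec m" unfolding w_def by (rule vsum_closed) (rule gc)
  have Sg: "S *\<^sub>v g \<mu> = f \<mu>" if "\<mu> \<in> J" for \<mu>
  proof -
    have m: "\<mu> \<in> I" "\<mu> \<noteq> e" using that unfolding J_def by auto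
    have "S *\<^sub>v g \<mu> = inverse (\<mu> - e) \<cdot>\<^sub>v (S *\<^sub>v f \<mu>)"
      unfolding g_def using Sc fc[OF m(1)] by (rule mult_mat_vec)
    also have "S *\<^sub>v f \<mu> = (\<mu> - e) \<cdot>\<^sub>v f \<mu>"
      unfolding S[OF fc[OF m(1)]] Tf[OF m(1)] by (intro eq_vecI) (auto simp: algebra_simps)
    finally show ?thesis using m by (simp add: smult_smult_assoc)
  qed
  have "S *\<^sub>v w = vsum m (\<lambda>\<mu>. S *\<^sub>v g \<mu>) J"
    unfolding w_def by (rule mult_mat_vec_vsum[OF _ gc Sc]) (simp_all add: fin J_def)
  also have "\<dots> = vsum m f J"
    by (rule vsum_cong) (simp_all add: fin J_def fc Sg[unfolded J_def])
  finally have Sw: "S *\<^sub>v w = vsum m f J" .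
  \<comment> \<open>The default zero vector treats the case without a summand for \<open>e\<close>
    uniformly.\<close>
  define z where "z = (if e \<in> I then f e else 0\<^sub>v m)"
  have zc: "z \<in> carrier_vec m" using fc unfolding z_def by auto
  have fJ: "vsum m f J \<in> carrier_vec m" using fc by (intro vsum_closed) (auto simp: J_def)
  have zf: "vsum m f I = z + vsum m f J"
  proof (cases "e \<in> I")
    case True
    then have I: "insert e J = I" unfolding J_def by auto
    have "vsum m f (insert e J) = f e + vsum m f J"
      by (rule vsum_insert) (use fin fc I in \<open>auto simp: J_def\<close>)
    then have "vsum m f I = f e + vsum m f J" unfolding I .
    then show ?thesis using True unfolding z_def by simp
  next
    case False
    then have "I = J" unfolding J_def by auto
    then show ?thesis using False fJ unfolding z_def by auto
  qed
  define y' where "y' = y - w"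
  have y'c: "y' \<in> carrier_vec m" using y wc unfolding y'_def by auto
  have Sy': "S *\<^sub>v y' = z"
  proof -
    have "S *\<^sub>v y' = S *\<^sub>v y - S *\<^sub>v w" unfolding y'_def by (rule mult_minus_distrib_mat_vec[OF Sc y wc])
    also have "\<dots> = (z + vsum m f J) - vsum m f J" unfolding S[OF y] sm Sw zf ..
    also have "\<dots> = z" using zc fJ by (intro eq_vecI) auto
    finally show ?thesis .
  qed
  have Tz: "T *\<^sub>v z = e \<cdot>\<^sub>v z" using Tf T(1) unfolding z_def by auto
  have bT: "bil B u (T *\<^sub>v v) = bil A u v" if "v \<in> carrier_vec m" for u v
    unfolding bil_def BT[OF that] ..
  \<comment> \<open>\<open>(T - e)\<^sup>2 y' = 0\<close> forces \<open>(T - e) y' = 0\<close>, as \<open>T\<close> is self-adjoint for the form of \<open>B\<close>.\<close>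
  have "bil B z z = bil B z (T *\<^sub>v y' - e \<cdot>\<^sub>v y')" using Sy' S[OF y'c] by simp
  also have "\<dots> = bil A z y' - e * bil B z y'"
    using B1 zc y'c T(1) by (simp add: bil_diff_right[of B m m] bil_smult_right[of B m m] bT)
  also have "bil A z y' = bil B y' (T *\<^sub>v z)"
    using bT[OF zc] bil_sym[OF A zc y'c] by simp
  also have "\<dots> = e * bil B z y'"
    unfolding Tz bil_smult_right[OF B1 y'c zc] bil_sym[OF B1 Bs y'c zc] ..
  finally have "z = 0\<^sub>v m" using spdD(5)[OF B zc] by simp
  then have "T *\<^sub>v y' = e \<cdot>\<^sub>v y'"
  proof -
    have "T *\<^sub>v y' - e \<cdot>\<^sub>v y' = 0\<^sub>v m" using Sy' S[OF y'c] \<open>z = 0\<^sub>v m\<close> by simp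
    then have "(T *\<^sub>v y' - e \<cdot>\<^sub>v y') $ i = 0" if "i < m" for i using that by simp
    then have "(T *\<^sub>v y') $ i = (e \<cdot>\<^sub>v y') $ i" if "i < m" for i
      using that y'c by fastforce
    then show ?thesis using T(1) y'c by (intro eq_vecI) auto
  qed
  then have Ay': "A *\<^sub>v y' = e \<cdot>\<^sub>v (B *\<^sub>v y')"
    using BT[OF y'c] mult_mat_vec[OF B1 y'c, of e] by simp
  \<comment> \<open>\<open>J\<close> omits \<open>e\<close>, so the update leaves the summands over
    \<open>J\<close> unchanged.\<close>
  define h where "h = g(e := y')"
  have hg: "h \<mu> = g \<mu>" if "\<mu> \<in> J" for \<mu> using that unfolding h_def J_def by auto
  have "vsum m h (insert e J) = h e + vsum m h J"
    using fin y'c gc hg by (intro vsum_insert) (auto simp: J_def h_def)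
  also have "vsum m h J = w" unfolding w_def
    using fin gc hg by (intro vsum_cong) (auto simp: J_def)
  also have "h e + w = y"
    using y wc unfolding h_def y'_def by (intro eq_vecI) auto
  finally have "y = vsum m h (insert e J)" by simp
  moreover have "A *\<^sub>v g \<mu> = \<mu> \<cdot>\<^sub>v (B *\<^sub>v g \<mu>)" if "\<mu> \<in> J" for \<mu>
  proof -
    have m: "\<mu> \<in> I" using that unfolding J_def by auto
    show ?thesis unfolding g_def mult_mat_vec[OF A(1) fc[OF m]] mult_mat_vec[OF B1 fc[OF m]] fe[OF m]
      by (simp add: smult_smult_assoc mult.commute)
  qed
  ultimately have "pencil_expansion m A B y (insert e J) h"
    using fin gc hg y'c Ay' unfolding pencil_expansion_def by (auto simp: J_def h_def)
  then show ?thesis by blast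
qed

text \<open>The characteristic polynomial of \<open>T\<close> splits, so \<open>T\<close> has a real
  Schur form \<open>P * U * Q\<close>, and the leading columns of \<open>P\<close> span invariant
  subspaces.\<close>

lemma pencil_expansion_exists:
  assumes A: "A \<in> carrier_mat m m" "A\<^sup>T = A" and B: "spd m B" and y: "y \<in> carrier_vec m"
  shows "\<exists>I f. pencil_expansion m A B y I f"
proof -
  note B1 = spdD(1)[OF B]
  obtain X where X: "X \<in> carrier_mat m m" "B * X = 1\<^sub>m m" using spd_obtain_inverse[OF B] by metis
  define T where "T = X * A"
  have T: "T \<in> carrier_mat m m" unfolding T_def using X A by auto
  have BT: "B * T = A" 
    unfolding T_def assoc_mult_mat[OF B1 X(1) A(1), symmetric] X(2) using A by simp
  obtain es where es: "char_poly T = (\<Prod>e\<leftarrow>es. [:- e, 1:])"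
    using pencil_char_poly_splits[OF A B T BT] .
  obtain U P Q where "schur_decomposition T es = (U, P, Q)" by (cases "schur_decomposition T es")
  from schur_decomposition[OF T es this]
  have "similar_mat_wit T U P Q" and tri: "upper_triangular U" by auto
  from similar_mat_witD2[OF T this(1)]
  have PQ: "P * Q = 1\<^sub>m m" "Q * P = 1\<^sub>m m" "T = P * U * Q" and U: "U \<in> carrier_mat m m"
    and P: "P \<in> carrier_mat m m" and Q: "Q \<in> carrier_mat m m" by auto
  have TP: "T *\<^sub>v (P *\<^sub>v c) = P *\<^sub>v (U *\<^sub>v c)" if "c \<in> carrier_vec m" for c
  proof -
    have "Q *\<^sub>v (P *\<^sub>v c) = c" using assoc_mult_mat_vec[OF Q P that] PQ(2) that by simp
    moreover have "T *\<^sub>v (P *\<^sub>v c) = P *\<^sub>v (U *\<^sub>v (Q *\<^sub>v (P *\<^sub>v c)))"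
      unfolding PQ(3) using P U Q that by (simp add: assoc_mult_mat_vec[of _ m m _ m])
    ultimately show ?thesis by simp
  qed
  \<comment> \<open>Induction along the flag: the coordinates \<open>c\<close> vanish from index
    \<open>k\<close> on. Subtracting the diagonal entry \<open>U $$ (k, k)\<close> leads from level
    \<open>Suc k\<close> to level \<open>k\<close>, and \<open>k = m\<close> covers all
    vectors.\<close>
  have flag: "\<exists>I f. pencil_expansion m A B (P *\<^sub>v c) I f"
    if "c \<in> carrier_vec m" "\<And>i. i < m \<Longrightarrow> k \<le> i \<Longrightarrow> c $ i = 0" "k \<le> m" for k c
    using that
  proof (induction k arbitrary: c)
    case 0
    then have "c = 0\<^sub>v m" by (intro eq_vecI) auto
    then have "P *\<^sub>v c = 0\<^sub>v m" using P by (intro eq_vecI) auto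
    then show ?case by (intro exI[of _ "{}"]) (simp add: pencil_expansion_def vsum_empty)
  next
    case (Suc k)
    define e where "e = U $$ (k, k)"
    define d where "d = U *\<^sub>v c - e \<cdot>\<^sub>v c"
    have k: "k < m" using Suc.prems by simp
    have d: "d \<in> carrier_vec m" unfolding d_def using U Suc.prems(1) by auto
    have "d $ i = 0" if "i < m" "k \<le> i" for i
    proof -
      have "(U *\<^sub>v c) $ i = e * c $ i" unfolding e_def
        by (rule mult_upper_triangular_vec[OF U tri Suc.prems(1) k _ that]) (use Suc.prems(2) in auto)
      then show ?thesis unfolding d_def using U that Suc.prems(1) by auto
    qed
    then have "\<exists>I f. pencil_expansion m A B (P *\<^sub>v d) I f"
      using k by (intro Suc.IH[OF d]) simp_all
    then obtain I f where "pencil_expansion m A B (P *\<^sub>v d) I f" by (elim exE)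
    moreover have "P *\<^sub>v d = T *\<^sub>v (P *\<^sub>v c) - e \<cdot>\<^sub>v (P *\<^sub>v c)"
      unfolding d_def TP[OF Suc.prems(1)] using P U Suc.prems(1)
      by (subst mult_minus_distrib_mat_vec[OF P]) (auto simp: mult_mat_vec[of P m m])
    ultimately show ?case
      using pencil_expansion_step[OF A B T BT, of "P *\<^sub>v c"] P Suc.prems(1) by auto
  qed
  have "P *\<^sub>v (Q *\<^sub>v y) = y" using assoc_mult_mat_vec[OF P Q y] PQ(1) y by simp
  moreover have "Q *\<^sub>v y \<in> carrier_vec m" using Q y by auto
  ultimately show ?thesis using flag[of "Q *\<^sub>v y" m] by auto
qed

section \<open>Bilinear forms on finite sums, and orthogonality\<close>

lemma bil_vsum_right:
  assumes "M \<in> carrier_mat n m" "x \<in> carrier_vec n" "finite J" "\<And>j. j \<in> J \<Longrightarrow> g j \<in> carrier_vec m"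
  shows "bil M x (vsum m g J) = (\<Sum>j\<in>J. bil M x (g j))"
proof -
  have "M *\<^sub>v vsum m g J = vsum n (\<lambda>j. M *\<^sub>v g j) J"
    by (rule mult_mat_vec_vsum[OF assms(3,4,1)])
  moreover have "x \<bullet> vsum n (\<lambda>j. M *\<^sub>v g j) J = (\<Sum>j\<in>J. x \<bullet> (M *\<^sub>v g j))"
    by (rule scalar_prod_vsum[OF assms(3) _ assms(2)]) (use assms in auto)
  ultimately show ?thesis unfolding bil_def by simp
qed

lemma bil_vsum_left:
  assumes "M \<in> carrier_mat n m" "y \<in> carrier_vec m" "finite I" "\<And>i. i \<in> I \<Longrightarrow> f i \<in> carrier_vec n"
  shows "bil M (vsum n f I) y = (\<Sum>i\<in>I. bil M (f i) y)"
proof -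
  have "bil M\<^sup>T y (vsum n f I) = (\<Sum>i\<in>I. bil M\<^sup>T y (f i))"
    by (rule bil_vsum_right[OF _ assms(2-4)]) (use assms(1) in auto)
  also have "\<dots> = (\<Sum>i\<in>I. bil M (f i) y)"
    by (rule sum.cong[OF refl]) (simp add: bil_transpose[OF assms(1) assms(4) assms(2)])
  finally show ?thesis using bil_transpose[OF assms(1) vsum_closed assms(2), of I f] assms(4) by simp
qed

lemma bil_vsum_vsum:
  assumes "M \<in> carrier_mat n m" "finite I" "finite J"
    "\<And>i. i \<in> I \<Longrightarrow> f i \<in> carrier_vec n" "\<And>j. j \<in> J \<Longrightarrow> g j \<in> carrier_vec m"
  shows "bil M (vsum n f I) (vsum m g J) = (\<Sum>i\<in>I. \<Sum>j\<in>J. bil M (f i) (g j))"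
proof -
  have "bil M (vsum n f I) (vsum m g J) = (\<Sum>i\<in>I. bil M (f i) (vsum m g J))"
    by (rule bil_vsum_left[OF assms(1) vsum_closed assms(2,4)]) (rule assms(5))
  also have "\<dots> = (\<Sum>i\<in>I. \<Sum>j\<in>J. bil M (f i) (g j))"
    by (rule sum.cong[OF refl], rule bil_vsum_right[OF assms(1) assms(4) assms(3,5)])
  finally show ?thesis .
qed

text \<open>Pythagoras, used for generalized eigenvectors and for subdomains of one color.\<close>

lemma bil_vsum_orthogonal:
  assumes "M \<in> carrier_mat n n" "finite I" "\<And>i. i \<in> I \<Longrightarrow> f i \<in> carrier_vec n"
    and "\<And>i j. i \<in> I \<Longrightarrow> j \<in> I \<Longrightarrow> i \<noteq> j \<Longrightarrow> bil M (f i) (f j) = 0"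
  shows "bil M (vsum n f I) (vsum n f I) = (\<Sum>i\<in>I. bil M (f i) (f i))"
proof -
  have "bil M (vsum n f I) (vsum n f I) = (\<Sum>i\<in>I. \<Sum>j\<in>I. bil M (f i) (f j))"
    by (rule bil_vsum_vsum[OF assms(1,2,2,3,3)])
  also have "\<dots> = (\<Sum>i\<in>I. \<Sum>j\<in>I. if j = i then bil M (f i) (f i) else 0)"
    by (intro sum.cong refl) (use assms(4) in auto)
  also have "\<dots> = (\<Sum>i\<in>I. bil M (f i) (f i))"
    by (intro sum.cong refl) (use assms(2) in simp)
  finally show ?thesis .
qed

lemma vsum_in_span:
  assumes "S \<subseteq> carrier_vec m" "finite I" "\<And>i. i \<in> I \<Longrightarrow> f i \<in> S"
  shows "vsum m f I \<in> LinearCombinations.module.span class_ring (module_vec TYPE(real) m) S"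
proof -
  interpret v: vec_space "TYPE(real)" m .
  show ?thesis
  proof (rule vsum_induct[OF assms(2)])
    show "f i \<in> carrier_vec m \<and> f i \<in> v.span S" if "i \<in> I" for i
      using assms(1) assms(3)[OF that] v.span_mem[OF assms(1)] by auto
    show "0\<^sub>v m \<in> v.span S" by (rule v.in_spanI[where A = "{}" and a = "\<lambda>_. 0"]) (simp_all add: v.lincomb_def)
    show "u + v \<in> v.span S" if "u \<in> v.span S" "v \<in> v.span S" for u v
      using v.span_add1[OF assms(1) that] .
  qed
qed

text \<open>The eigenvector expansion of \<open>y\<close> is cut at \<tau>. Eigenvectors for
  different eigenvalues are orthogonal for both forms, so all energies are sums over single
  eigenvalues and can be compared term by term.\<close>

lemma pencil_split:
  assumes A: "A \<in> carrier_mat m m" "A\<^sup>T = A" and B: "spd m B" and y: "y \<in> carrier_vec m"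
  obtains l h where "l \<in> YL m \<tau> A B" "h \<in> YH m \<tau> A B" "l \<in> carrier_vec m" "h \<in> carrier_vec m"
    "y = l + h" "bil A l h = 0" "bil B l h = 0"
    "bil A l l \<le> \<tau> * bil B l l" "\<tau> * bil B h h \<le> bil A h h"
proof -
  note B1 = spdD(1)[OF B] and Bs = spdD(2)[OF B]
  obtain I f where ex: "pencil_expansion m A B y I f" using pencil_expansion_exists[OF A B y] by blast
  have fin: "finite I" and sm: "y = vsum m f I"
    and fc: "\<And>\<mu>. \<mu> \<in> I \<Longrightarrow> f \<mu> \<in> carrier_vec m"
    and fe: "\<And>\<mu>. \<mu> \<in> I \<Longrightarrow> A *\<^sub>v f \<mu> = \<mu> \<cdot>\<^sub>v (B *\<^sub>v f \<mu>)"
    using ex unfolding pencil_expansion_def by auto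
  have AB: "bil A x (f \<mu>) = \<mu> * bil B x (f \<mu>)" if "\<mu> \<in> I" "x \<in> carrier_vec m" for \<mu> x
    using that B1 fc[OF that(1)] unfolding bil_def fe[OF that(1)] by simp
  \<comment> \<open>By symmetry of both forms, \<open>b = bil B (f \<mu>) (f \<nu>)\<close>
    satisfies \<open>\<mu> * b = \<nu> * b\<close>.\<close>
  have oB: "bil B (f \<mu>) (f \<nu>) = 0" if "\<mu> \<in> I" "\<nu> \<in> I" "\<mu> \<noteq> \<nu>" for \<mu> \<nu>
    using AB[OF that(2) fc[OF that(1)]] AB[OF that(1) fc[OF that(2)]]
      bil_sym[OF A fc[OF that(1)] fc[OF that(2)]] bil_sym[OF B1 Bs fc[OF that(1)] fc[OF that(2)]] that(3)
    by simp
  have oA: "bil A (f \<mu>) (f \<nu>) = 0" if "\<mu> \<in> I" "\<nu> \<in> I" "\<mu> \<noteq> \<nu>" for \<mu> \<nu>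
    using AB[OF that(2) fc[OF that(1)]] oB[OF that] by simp
  define L where "L = {\<mu> \<in> I. \<mu> < \<tau>}"
  define H where "H = {\<mu> \<in> I. \<mu> \<ge> \<tau>}"
  have LI: "finite L" "finite H" "L \<subseteq> I" "H \<subseteq> I" "L \<inter> H = {}" "L \<union> H = I"
    using fin unfolding L_def H_def by auto
  have fL: "\<And>\<mu>. \<mu> \<in> L \<Longrightarrow> f \<mu> \<in> carrier_vec m" and fH: "\<And>\<mu>. \<mu> \<in> H \<Longrightarrow> f \<mu> \<in> carrier_vec m"
    using fc LI by blast+
  show ?thesis
  proof (rule that)
    show "vsum m f L \<in> YL m \<tau> A B" unfolding YL_def
      by (rule vsum_in_span) (use fc fe LI in \<open>auto simp: L_def\<close>)
    show "vsum m f H \<in> YH m \<tau> A B" unfolding YH_def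
      by (rule vsum_in_span) (use fc fe LI in \<open>auto simp: H_def\<close>)
    show "vsum m f L \<in> carrier_vec m" by (rule vsum_closed[OF fL])
    show "vsum m f H \<in> carrier_vec m" by (rule vsum_closed[OF fH])
    show "y = vsum m f L + vsum m f H" unfolding sm LI(6)[symmetric]
      by (rule vsum_Un_disjoint[OF LI(1,2,5)]) (use fL fH in blast)
    show "bil A (vsum m f L) (vsum m f H) = 0"
    proof -
      have "bil A (vsum m f L) (vsum m f H) = (\<Sum>\<mu>\<in>L. \<Sum>\<nu>\<in>H. bil A (f \<mu>) (f \<nu>))"
        by (rule bil_vsum_vsum[OF A(1) LI(1,2) fL fH])
      also have "\<dots> = 0" using oA LI(3-5) by (intro sum.neutral ballI) blast
      finally show ?thesis .
    qed
    show "bil B (vsum m f L) (vsum m f H) = 0"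
    proof -
      have "bil B (vsum m f L) (vsum m f H) = (\<Sum>\<mu>\<in>L. \<Sum>\<nu>\<in>H. bil B (f \<mu>) (f \<nu>))"
        by (rule bil_vsum_vsum[OF B1 LI(1,2) fL fH])
      also have "\<dots> = 0" using oB LI(3-5) by (intro sum.neutral ballI) blast
      finally show ?thesis .
    qed
    have L: "bil A (vsum m f L) (vsum m f L) = (\<Sum>\<mu>\<in>L. bil A (f \<mu>) (f \<mu>))"
      "bil B (vsum m f L) (vsum m f L) = (\<Sum>\<mu>\<in>L. bil B (f \<mu>) (f \<mu>))"
      using LI(3) by (auto intro!: bil_vsum_orthogonal A(1) B1 LI(1) fL oA oB)
    have H: "bil A (vsum m f H) (vsum m f H) = (\<Sum>\<mu>\<in>H. bil A (f \<mu>) (f \<mu>))"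
      "bil B (vsum m f H) (vsum m f H) = (\<Sum>\<mu>\<in>H. bil B (f \<mu>) (f \<mu>))"
      using LI(4) by (auto intro!: bil_vsum_orthogonal A(1) B1 LI(2) fH oA oB)
    show "bil A (vsum m f L) (vsum m f L) \<le> \<tau> * bil B (vsum m f L) (vsum m f L)"
      unfolding L sum_distrib_left
    proof (rule sum_mono)
      fix \<mu> assume m: "\<mu> \<in> L"
      then have "\<mu> * bil B (f \<mu>) (f \<mu>) \<le> \<tau> * bil B (f \<mu>) (f \<mu>)"
        using spdD(4)[OF B fL[OF m]] by (intro mult_right_mono) (auto simp: L_def)
      then show "bil A (f \<mu>) (f \<mu>) \<le> \<tau> * bil B (f \<mu>) (f \<mu>)"
        using AB[OF _ fL[OF m], of \<mu>] m LI(3) by auto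
    qed
    show "\<tau> * bil B (vsum m f H) (vsum m f H) \<le> bil A (vsum m f H) (vsum m f H)"
      unfolding H sum_distrib_left
    proof (rule sum_mono)
      fix \<mu> assume m: "\<mu> \<in> H"
      then have "\<tau> * bil B (f \<mu>) (f \<mu>) \<le> \<mu> * bil B (f \<mu>) (f \<mu>)"
        using spdD(4)[OF B fH[OF m]] by (intro mult_right_mono) (auto simp: H_def)
      then show "\<tau> * bil B (f \<mu>) (f \<mu>) \<le> bil A (f \<mu>) (f \<mu>)"
        using AB[OF _ fH[OF m], of \<mu>] m LI(4) by auto
    qed
  qed
qed

section \<open>Local splittings and the coarse space\<close>

lemma scalar_prod_self_eq_0:
  fixes x :: "real vec"
  assumes "x \<in> carrier_vec m" "x \<bullet> x \<le> 0"
  shows "x = 0\<^sub>v m"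
proof -
  have "x \<bullet> x = (\<Sum>i\<in>{0..<m}. (x $ i)\<^sup>2)"
    using assms(1) by (auto simp: scalar_prod_def power2_eq_square)
  then have "(\<Sum>i\<in>{0..<m}. (x $ i)\<^sup>2) = 0"
    using assms(2) sum_nonneg[of "{0..<m}" "\<lambda>i. (x $ i)\<^sup>2"] by simp
  then have "\<forall>i\<in>{0..<m}. x $ i = 0"
    by (simp add: sum_nonneg_eq_0_iff)
  then show ?thesis using assms(1) by (intro eq_vecI) auto
qed

lemma spsdD:
  assumes "spsd m M"
  shows "M \<in> carrier_mat m m" "M\<^sup>T = M" "\<And>x. x \<in> carrier_vec m \<Longrightarrow> 0 \<le> bil M x x"
  using assms unfolding spsd_def bil_def by auto

text \<open>The form is nonnegative at \<open>x - s w\<close> with \<open>w = M x\<close>. As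
  \<open>bil M x x\<close> contributes nothing positive, the term linear in \<open>s\<close> would
  dominate for small \<open>s > 0\<close> unless \<open>w \<bullet> w\<close> is zero.\<close>

lemma spsd_isotropic_in_kernel:
  assumes M: "spsd m M" and x: "x \<in> carrier_vec m" "bil M x x \<le> 0"
  shows "M *\<^sub>v x = 0\<^sub>v m"
proof (rule scalar_prod_self_eq_0)
  note M1 = spsdD(1)[OF M] and Ms = spsdD(2)[OF M]
  define w where "w = M *\<^sub>v x"
  show w: "M *\<^sub>v x \<in> carrier_vec m" using M1 x by auto
  then have w': "w \<in> carrier_vec m" unfolding w_def .
  define a where "a = w \<bullet> w"
  define b where "b = bil M w w"
  have b: "b \<ge> 0" unfolding b_def by (rule spsdD(3)[OF M w'])
  have wx: "bil M w x = a" unfolding a_def bil_def w_def ..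
  have xw: "bil M x w = a" using bil_sym[OF M1 Ms x(1) w'] wx by simp
  \<comment> \<open>The minimizer would be \<open>a / b\<close>; the added 1 keeps the denominator
    positive when \<open>b = 0\<close>.\<close>
  define s where "s = a / (b + 1)"
  have sb: "s * (b + 1) = a" unfolding s_def using b by simp
  have "0 \<le> bil M (x - s \<cdot>\<^sub>v w) (x - s \<cdot>\<^sub>v w)" using x w' by (intro spsdD(3)[OF M]) auto
  also have "\<dots> = bil M x x - 2 * s * a + s * s * b"
    using M1 x(1) w'
    by (simp add: bil_diff_left[of M m m] bil_diff_right[of M m m] bil_smult_left[of M m m]
        bil_smult_right[of M m m] wx xw b_def algebra_simps)
  finally have "2 * s * a \<le> s * s * b" using x(2) by simp
  then have "2 * s * (s * (b + 1)) \<le> s * s * b" unfolding sb .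
  then have "s * s * (b + 2) \<le> 0" by (simp add: algebra_simps)
  then have "s = 0" using b
    by (metis add_nonneg_pos mult_le_0_iff not_real_square_gt_zero not_less zero_less_numeral)
  then have "a = 0" using sb by simp
  then show "(M *\<^sub>v x) \<bullet> (M *\<^sub>v x) \<le> 0" unfolding a_def w_def by simp
qed

text \<open>The definition leaves the shape of the inverse open; comparing column counts in the two
  identities fixes it.\<close>

lemma invertible_matD:
  assumes "invertible_mat B" "B \<in> carrier_mat m m"
  obtains X where "X \<in> carrier_mat m m" "B * X = 1\<^sub>m m" "X * B = 1\<^sub>m m"
proof -
  obtain X where X: "B * X = 1\<^sub>m (dim_row B)" "X * B = 1\<^sub>m (dim_row X)"
    using assms unfolding invertible_mat_def inverts_mat_def by auto
  from arg_cong[OF X(1), of dim_col] arg_cong[OF X(2), of dim_col]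
  have "dim_col X = m" "dim_row X = m" using assms(2) by auto
  then show ?thesis using that[of X] X assms(2) by auto
qed

lemma invertible_spsd_imp_spd:
  assumes M: "spsd m M" and inv: "invertible_mat M"
  shows "spd m M"
proof -
  note M1 = spsdD(1)[OF M]
  obtain X where X: "X \<in> carrier_mat m m" "X * M = 1\<^sub>m m"
    using invertible_matD[OF inv M1] by metis
  have "0 < bil M x x" if x: "x \<in> carrier_vec m" "x \<noteq> 0\<^sub>v m" for x
  proof (rule ccontr)
    assume "\<not> 0 < bil M x x"
    then have "M *\<^sub>v x = 0\<^sub>v m" by (intro spsd_isotropic_in_kernel[OF M x(1)]) simp
    moreover have "X *\<^sub>v (M *\<^sub>v x) = x"
      using assoc_mult_mat_vec[OF X(1) M1 x(1)] X(2) x(1) by simp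
    ultimately show False using x(2) X(1) by auto
  qed
  then show ?thesis using spsdD[OF M] unfolding spd_def bil_def by auto
qed

lemma mat_range_eq_span:
  assumes "B \<in> carrier_mat m k"
  shows "mat_range B = LinearCombinations.module.span class_ring (module_vec TYPE(real) m) (set (cols B))"
proof -
  interpret v: vec_space "TYPE(real)" m .
  show ?thesis
    using v.col_space_eq[OF assms] assms unfolding v.col_space_def mat_range_def by auto
qed

text \<open>The basis property is relative to the subspace as a vector space of its own; here span
  and independence are transferred to the ambient space.\<close>

lemma subspace_basis:
  assumes W: "VectorSpace.subspace class_ring W (module_vec TYPE(real) m)"
    and b: "vectorspace.basis class_ring (subspace_vs m W) S"
  shows "S \<subseteq> W" "LinearCombinations.module.span class_ring (module_vec TYPE(real) m) S = W"
    "\<not> module.lin_dep class_ring (module_vec TYPE(real) m) S"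
proof -
  interpret v: vec_space "TYPE(real)" m .
  interpret w: vectorspace class_ring "subspace_vs m W" by (rule v.subspace_is_vs[OF W])
  from b show S: "S \<subseteq> W" unfolding w.basis_def by auto
  have sub: "submodule class_ring W (module_vec TYPE(real) m)"
    using W unfolding VectorSpace.subspace_def by auto
  show "v.span S = W" "\<not> v.lin_dep S"
    using b v.span_li_not_depend[OF S sub] unfolding w.basis_def by auto
qed

lemma subspace_mat_range:
  assumes "B \<in> carrier_mat m k"
  shows "VectorSpace.subspace class_ring (mat_range B) (module_vec TYPE(real) m)"
proof -
  interpret v: vec_space "TYPE(real)" m .
  show ?thesis unfolding mat_range_eq_span[OF assms]
    by (rule v.span_is_subspace) (use cols_dim[of B] assms in auto)
qed

lemma orthonormal_basis_cols_mat_range: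
  assumes M: "M \<in> carrier_mat m k" and W: "W \<in> carrier_mat m r"
    and o: "orthonormal_basis_cols m (mat_range M) W"
  shows "mat_range W = mat_range M" "W\<^sup>T * W = 1\<^sub>m r"
proof -
  have "vectorspace.basis class_ring (subspace_vs m (mat_range M)) (set (cols W))"
    using o unfolding orthonormal_basis_cols_def by auto
  from subspace_basis(2)[OF subspace_mat_range[OF M] this]
  show "mat_range W = mat_range M" unfolding mat_range_eq_span[OF W] .
  show "W\<^sup>T * W = 1\<^sub>m r"
    using o W unfolding orthonormal_basis_cols_def by (intro eq_matI) auto
qed

text \<open>A basis is a set and could hide repeated rows. Since the number of rows equals the
  dimension, the rows are distinct, and a nonzero kernel vector of the transpose would be a linear
  dependence among them.\<close>

lemma coarse_settingD:
  assumes "coarse_setting n V0 R0"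
  obtains k where "R0 \<in> carrier_mat k n" "V0 = mat_range (R0\<^sup>T)"
    "\<And>c. c \<in> carrier_vec k \<Longrightarrow> R0\<^sup>T *\<^sub>v c = 0\<^sub>v n \<Longrightarrow> c = 0\<^sub>v k"
proof -
  interpret v: vec_space "TYPE(real)" n .
  define k where "k = vectorspace.dim class_ring (subspace_vs n V0)"
  have sub: "VectorSpace.subspace class_ring V0 (module_vec TYPE(real) n)"
    and R0: "R0 \<in> carrier_mat k n"
    and bas: "vectorspace.basis class_ring (subspace_vs n V0) (set (rows R0))"
    using assms unfolding coarse_setting_def k_def by auto
  interpret w: vectorspace class_ring "subspace_vs n V0" by (rule v.subspace_is_vs[OF sub])
  have RT: "R0\<^sup>T \<in> carrier_mat n k" using R0 by auto
  have V0: "V0 = mat_range (R0\<^sup>T)"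
    using subspace_basis(2)[OF sub bas] unfolding mat_range_eq_span[OF RT] by simp
  have "card (set (rows R0)) = length (rows R0)"
    using w.dim_basis[OF finite_set bas] R0 unfolding k_def by simp
  then have dist: "distinct (cols (R0\<^sup>T))" by (simp add: card_distinct)
  show ?thesis
  proof (rule that[OF R0 V0])
    fix c assume c: "c \<in> carrier_vec k" "R0\<^sup>T *\<^sub>v c = 0\<^sub>v n"
    show "c = 0\<^sub>v k"
      using v.lin_depI[OF RT c(1) _ c(2) dist] subspace_basis(3)[OF sub bas] by auto
  qed
qed

section \<open>Congruences and the GenEO splitting of a local vector\<close>

lemma bil_congruence:
  assumes "W \<in> carrier_mat m r" "M \<in> carrier_mat m m" "x \<in> carrier_vec r" "y \<in> carrier_vec r"
  shows "bil (W\<^sup>T * M * W) x y = bil M (W *\<^sub>v x) (W *\<^sub>v y)"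
proof -
  have "(W\<^sup>T * M * W) *\<^sub>v y = W\<^sup>T *\<^sub>v (M *\<^sub>v (W *\<^sub>v y))"
    using assms by (simp add: assoc_mult_mat_vec[of _ r m _ r] assoc_mult_mat_vec[of _ r m _ m])
  moreover have "x \<bullet> (W\<^sup>T *\<^sub>v (M *\<^sub>v (W *\<^sub>v y))) = (W *\<^sub>v x) \<bullet> (M *\<^sub>v (W *\<^sub>v y))"
    using transpose_vec_mult_scalar[of "W\<^sup>T" r m "M *\<^sub>v (W *\<^sub>v y)" x] assms by simp
  ultimately show ?thesis unfolding bil_def by simp
qed

lemma congruence_symmetric:
  fixes M :: "real mat"
  assumes "W \<in> carrier_mat m r" "M \<in> carrier_mat m m" "M\<^sup>T = M"
  shows "W\<^sup>T * M * W \<in> carrier_mat r r" "(W\<^sup>T * M * W)\<^sup>T = W\<^sup>T * M * W"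
proof -
  show "W\<^sup>T * M * W \<in> carrier_mat r r" using assms by auto
  have "(W\<^sup>T * M * W)\<^sup>T = W\<^sup>T * (W\<^sup>T * M)\<^sup>T"
    using assms by (intro transpose_mult[of _ r m _ r]) auto
  also have "(W\<^sup>T * M)\<^sup>T = M\<^sup>T * W"
    using assms by (subst transpose_mult[of _ r m _ m]) auto
  finally show "(W\<^sup>T * M * W)\<^sup>T = W\<^sup>T * M * W"
    unfolding assms(3) using assms by (simp add: assoc_mult_mat[of _ r m _ m _ r])
qed

text \<open>Applied with \<open>W\<close> a transposed restriction: to the coarse matrix and to the
  local blocks of \<open>A\<close>.\<close>

lemma congruence_spd:
  assumes M: "spd m M" and W: "W \<in> carrier_mat m r"
    and inj: "\<And>w. w \<in> carrier_vec r \<Longrightarrow> W *\<^sub>v w = 0\<^sub>v m \<Longrightarrow> w = 0\<^sub>v r"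
  shows "spd r (W\<^sup>T * M * W)"
proof -
  note M1 = spdD(1)[OF M] and Ms = spdD(2)[OF M]
  have "0 < bil (W\<^sup>T * M * W) w w" if "w \<in> carrier_vec r" "w \<noteq> 0\<^sub>v r" for w
    unfolding bil_congruence[OF W M1 that(1,1)]
    using that inj[OF that(1)] W by (intro spdD(3)[OF M]) auto
  then show ?thesis using congruence_symmetric[OF W M1 Ms] unfolding spd_def bil_def by auto
qed

lemma geneo_split:
  assumes At: "spd m At" and M: "spsd m M" and R: "Rs \<in> carrier_mat m n" and tau: "\<tau> > 0"
    and cond: "geneo_condition m V0 \<tau> Rs At M" and y: "y \<in> carrier_vec m"
  obtains g b where "g \<in> carrier_vec m" "b \<in> carrier_vec m" "y = g + b" "Rs\<^sup>T *\<^sub>v b \<in> V0"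
    "bil At g g \<le> \<tau> * bil M y y"
proof -
  note A1 = spdD(1)[OF At] and As = spdD(2)[OF At]
  note M1 = spsdD(1)[OF M] and Ms = spsdD(2)[OF M]
  consider (a) "geneo_a m V0 \<tau> Rs At M" | (b) "geneo_b m V0 \<tau> Rs At M" | (c) "geneo_c m V0 \<tau> Rs At M"
    using cond unfolding geneo_condition_def by auto
  then show ?thesis
  proof cases
    case a
    \<comment> \<open>With \<open>M\<close> on the left of the pencil the bad vectors are the low
      ones, and the threshold is inverted.\<close>
    obtain l h where lh: "l \<in> YL m (inverse \<tau>) M At" "l \<in> carrier_vec m" "h \<in> carrier_vec m"
      "y = l + h" "bil M l h = 0" "inverse \<tau> * bil At h h \<le> bil M h h"
      using pencil_split[OF M1 Ms At y, of "inverse \<tau>"] by metis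
    have "bil M y y = bil M l l + bil M h h"
      using lh(2-5) M1 bil_sym[OF M1 Ms lh(2,3)]
      by (simp add: bil_add_left[of M m m] bil_add_right[of M m m])
    then have "bil M h h \<le> bil M y y" using spsdD(3)[OF M lh(2)] by simp
    with lh(6) have "inverse \<tau> * bil At h h \<le> bil M y y" by simp
    then have "bil At h h \<le> \<tau> * bil M y y" using tau by (simp add: field_simps)
    moreover have "Rs\<^sup>T *\<^sub>v l \<in> V0" using a lh(1) unfolding geneo_a_def by auto
    moreover have "y = h + l" using lh(2-4) comm_add_vec by metis
    ultimately show ?thesis using that[of h l] lh(2,3) by auto
  next
    case b
    then have Mspd: "spd m M" using invertible_spsd_imp_spd[OF M] unfolding geneo_b_def by auto
    obtain l h where lh: "h \<in> YH m \<tau> At M" "l \<in> carrier_vec m" "h \<in> carrier_vec m"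
      "y = l + h" "bil M l h = 0" "bil At l l \<le> \<tau> * bil M l l"
      using pencil_split[OF A1 As Mspd y, of \<tau>] by metis
    have "bil M y y = bil M l l + bil M h h"
      using lh(2-5) M1 bil_sym[OF M1 Ms lh(2,3)]
      by (simp add: bil_add_left[of M m m] bil_add_right[of M m m])
    then have "\<tau> * bil M l l \<le> \<tau> * bil M y y" using spsdD(3)[OF M lh(3)] tau by simp
    with lh(6) have "bil At l l \<le> \<tau> * bil M y y" by simp
    moreover have "Rs\<^sup>T *\<^sub>v h \<in> V0" using b lh(1) unfolding geneo_b_def by auto
    ultimately show ?thesis using that[of l h] lh(2-4) by auto
  next
    case c
    define r where "r = vec_space.rank m M"
    obtain W where W: "W \<in> carrier_mat m r" and o: "orthonormal_basis_cols m (mat_range M) W"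
      and V: "(*\<^sub>v) (Rs\<^sup>T) ` {u + W *\<^sub>v w | u w. u \<in> mat_kernel M \<and>
            w \<in> YH r \<tau> (W\<^sup>T * At * W) (W\<^sup>T * M * W)} \<subseteq> V0"
      using c unfolding geneo_c_def r_def by auto
    note ran = orthonormal_basis_cols_mat_range(1)[OF M1 W o]
      and WW = orthonormal_basis_cols_mat_range(2)[OF M1 W o]
    have WT: "W\<^sup>T \<in> carrier_mat r m" using W by auto
    have WWv: "W\<^sup>T *\<^sub>v (W *\<^sub>v w) = w" if "w \<in> carrier_vec r" for w
      using assoc_mult_mat_vec[OF WT W that] WW that by simp
    have rangeM: "\<exists>c\<in>carrier_vec r. M *\<^sub>v z = W *\<^sub>v c" if "z \<in> carrier_vec m" for z
      using ran that W M1 unfolding mat_range_def by (force simp: image_iff set_eq_iff)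
    have rangeW: "\<exists>z\<in>carrier_vec m. W *\<^sub>v c = M *\<^sub>v z" if "c \<in> carrier_vec r" for c
      using ran that W M1 unfolding mat_range_def by (force simp: image_iff set_eq_iff)
    \<comment> \<open>An isotropic vector \<open>W w\<close> would lie in the kernel and in the
      range of \<open>M\<close>. These are orthogonal because \<open>M\<close> is symmetric, so
      \<open>W w\<close> would be zero.\<close>
    have spdW: "spd r (W\<^sup>T * M * W)"
    proof -
      have "0 < bil (W\<^sup>T * M * W) w w" if w: "w \<in> carrier_vec r" "w \<noteq> 0\<^sub>v r" for w
      proof (rule ccontr)
        assume "\<not> 0 < bil (W\<^sup>T * M * W) w w"
        then have le: "bil M (W *\<^sub>v w) (W *\<^sub>v w) \<le> 0" unfolding bil_congruence[OF W M1 w(1,1)] by simp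
        have Ww: "W *\<^sub>v w \<in> carrier_vec m" using W w by auto
        have MW: "M *\<^sub>v (W *\<^sub>v w) = 0\<^sub>v m" by (rule spsd_isotropic_in_kernel[OF M Ww le])
        obtain z where z: "z \<in> carrier_vec m" "W *\<^sub>v w = M *\<^sub>v z" using rangeW[OF w(1)] by blast
        have "(W *\<^sub>v w) \<bullet> (W *\<^sub>v w) = bil M (W *\<^sub>v w) z" unfolding bil_def z(2) ..
        also have "\<dots> = bil M z (W *\<^sub>v w)" by (rule bil_sym[OF M1 Ms Ww z(1)])
        also have "\<dots> = 0" unfolding bil_def MW using z(1) by simp
        finally have "W *\<^sub>v w = 0\<^sub>v m" by (intro scalar_prod_self_eq_0[OF Ww]) simp
        then have "w = W\<^sup>T *\<^sub>v 0\<^sub>v m" using WWv[OF w(1)] by simp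
        then show False using w(2) WT by auto
      qed
      then show ?thesis using congruence_symmetric[OF W M1 Ms] unfolding spd_def bil_def by auto
    qed
    \<comment> \<open>\<open>W w\<close> is the Euclidean orthogonal projection of \<open>y\<close>
      onto the range of \<open>M\<close>, and \<open>u\<close> is the remainder, which lies in the
      kernel.\<close>
    define w where "w = W\<^sup>T *\<^sub>v y"
    define u where "u = y - W *\<^sub>v w"
    have w: "w \<in> carrier_vec r" unfolding w_def using WT y by auto
    have Ww: "W *\<^sub>v w \<in> carrier_vec m" using W w by auto
    have u: "u \<in> carrier_vec m" unfolding u_def using y Ww by auto
    have WTu: "W\<^sup>T *\<^sub>v u = 0\<^sub>v r"
      unfolding u_def mult_minus_distrib_mat_vec[OF WT y Ww] WWv[OF w] w_def[symmetric]
      using w by simp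
    \<comment> \<open>The squared length of \<open>M u\<close> is the product of \<open>u\<close>
      with \<open>M (M u)\<close>, a vector in the range of \<open>W\<close>, to which
      \<open>u\<close> is orthogonal.\<close>
    have Mu: "M *\<^sub>v u = 0\<^sub>v m"
    proof (rule scalar_prod_self_eq_0)
      show Mu': "M *\<^sub>v u \<in> carrier_vec m" using M1 u by auto
      obtain c where cc: "c \<in> carrier_vec r" "M *\<^sub>v (M *\<^sub>v u) = W *\<^sub>v c" using rangeM[OF Mu'] by blast
      have "(M *\<^sub>v u) \<bullet> (M *\<^sub>v u) = bil M u (M *\<^sub>v u)"
        using bil_sym[OF M1 Ms Mu' u] unfolding bil_def by simp
      also have "\<dots> = bil W u c" unfolding bil_def cc(2) ..
      also have "\<dots> = bil (W\<^sup>T) c u" by (rule bil_transpose[OF W u cc(1)])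
      also have "\<dots> = 0" unfolding bil_def WTu using cc(1) by simp
      finally show "(M *\<^sub>v u) \<bullet> (M *\<^sub>v u) \<le> 0" by simp
    qed
    have yu: "y = u + W *\<^sub>v w"
      unfolding u_def using y carrier_vecD[OF Ww] W by (intro eq_vecI) auto
    have My: "bil M y y = bil M (W *\<^sub>v w) (W *\<^sub>v w)"
    proof -
      have "bil M v u = 0" if "v \<in> carrier_vec m" for v unfolding bil_def Mu using that by simp
      moreover have "bil M u v = 0" if "v \<in> carrier_vec m" for v
        using bil_sym[OF M1 Ms u that] calculation[OF that] by simp
      ultimately show ?thesis unfolding yu using M1 u Ww
        by (simp add: bil_add_left[of M m m] bil_add_right[of M m m])
    qed
    have WA: "W\<^sup>T * At * W \<in> carrier_mat r r" "(W\<^sup>T * At * W)\<^sup>T = W\<^sup>T * At * W"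
      by (rule congruence_symmetric[OF W A1 As])+
    note B1 = spdD(1)[OF spdW] and Bs = spdD(2)[OF spdW]
    obtain l h where lh: "h \<in> YH r \<tau> (W\<^sup>T * At * W) (W\<^sup>T * M * W)" "l \<in> carrier_vec r" "h \<in> carrier_vec r"
      "w = l + h" "bil (W\<^sup>T * M * W) l h = 0"
      "bil (W\<^sup>T * At * W) l l \<le> \<tau> * bil (W\<^sup>T * M * W) l l"
      using pencil_split[OF WA spdW w, of \<tau>] by metis
    have "bil (W\<^sup>T * M * W) w w = bil (W\<^sup>T * M * W) l l + bil (W\<^sup>T * M * W) h h"
      using lh(2-5) B1 bil_sym[OF B1 Bs lh(2,3)]
      by (simp add: bil_add_left[of "W\<^sup>T * M * W" r r] bil_add_right[of "W\<^sup>T * M * W" r r])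
    then have "bil (W\<^sup>T * M * W) l l \<le> bil M y y"
      using spdD(4)[OF spdW lh(3)] unfolding My bil_congruence[OF W M1 w w, symmetric] by simp
    then have "\<tau> * bil (W\<^sup>T * M * W) l l \<le> \<tau> * bil M y y" using tau by simp
    with lh(6) have main: "bil At (W *\<^sub>v l) (W *\<^sub>v l) \<le> \<tau> * bil M y y"
      unfolding bil_congruence[OF W A1 lh(2,2)] by simp
    define b where "b = u + W *\<^sub>v h"
    have Wl: "W *\<^sub>v l \<in> carrier_vec m" and Wh: "W *\<^sub>v h \<in> carrier_vec m" using W lh by auto
    have "u \<in> mat_kernel M" using u Mu M1 unfolding mat_kernel_def by auto
    then have "Rs\<^sup>T *\<^sub>v b \<in> V0" using V lh(1) unfolding b_def by blast
    moreover have "y = W *\<^sub>v l + b"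
      unfolding yu lh(4) b_def mult_add_distrib_mat_vec[OF W lh(2,3)]
      using u Wl Wh by (intro eq_vecI) auto
    ultimately show ?thesis using that[of "W *\<^sub>v l" b] main Wl Wh u unfolding b_def by auto
  qed
qed

section \<open>One-level operator, sharp constant and coloring\<close>

text \<open>The definite description calls for uniqueness: cancelling \<open>B\<close> on both sides
  of \<open>B * Z * B = B\<close> forces \<open>Z\<close> to be the inverse.\<close>

lemma pinv_invertible:
  assumes B: "B \<in> carrier_mat m m" and inv: "invertible_mat B"
  shows "pinv B \<in> carrier_mat m m" "B * pinv B = 1\<^sub>m m"
proof -
  obtain X where X: "X \<in> carrier_mat m m" "B * X = 1\<^sub>m m" "X * B = 1\<^sub>m m"
    using invertible_matD[OF inv B] .
  have "is_moore_penrose B X" using B X unfolding is_moore_penrose_def by auto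
  moreover have "Z = X" if "is_moore_penrose B Z" for Z
  proof -
    have Z: "Z \<in> carrier_mat m m" and BZB: "B * Z * B = B"
      using that B unfolding is_moore_penrose_def by auto
    have "X * (B * Z * B) * X = (X * B) * Z * (B * X)"
      using B X(1) Z by (simp add: assoc_mult_mat[of _ m m _ m _ m])
    then show ?thesis unfolding BZB X(2,3) using X Z by simp
  qed
  ultimately have "pinv B = X" unfolding pinv_def by (rule the_equality)
  then show "pinv B \<in> carrier_mat m m" "B * pinv B = 1\<^sub>m m" using X by auto
qed

lemma sum_mats_mult_vec:
  assumes "finite I" "\<And>s. s \<in> I \<Longrightarrow> F s \<in> carrier_mat nr nc" "x \<in> carrier_vec nc"
  shows "sum_mats nr nc F I *\<^sub>v x = vsum nr (\<lambda>s. F s *\<^sub>v x) I"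
proof (rule eq_vecI)
  have Fx: "F s *\<^sub>v x \<in> carrier_vec nr" if "s \<in> I" for s
    by (rule mult_mat_vec_carrier[OF assms(2)[OF that] assms(3)])
  have c: "vsum nr (\<lambda>s. F s *\<^sub>v x) I \<in> carrier_vec nr" by (rule vsum_closed[OF Fx])
  then show "dim_vec (sum_mats nr nc F I *\<^sub>v x) = dim_vec (vsum nr (\<lambda>s. F s *\<^sub>v x) I)"
    by (simp add: sum_mats_def)
  fix i assume "i < dim_vec (vsum nr (\<lambda>s. F s *\<^sub>v x) I)"
  then have i: "i < nr" using c by simp
  have "(sum_mats nr nc F I *\<^sub>v x) $ i = (\<Sum>j\<in>{0..<nc}. (\<Sum>s\<in>I. F s $$ (i, j)) * x $ j)"
    using i assms(3) by (simp add: sum_mats_def scalar_prod_def)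
  also have "\<dots> = (\<Sum>s\<in>I. \<Sum>j\<in>{0..<nc}. F s $$ (i, j) * x $ j)"
    unfolding sum_distrib_right by (rule sum.swap)
  also have "\<dots> = (\<Sum>s\<in>I. (F s *\<^sub>v x) $ i)"
  proof (rule sum.cong[OF refl])
    fix s assume "s \<in> I"
    then have "F s \<in> carrier_mat nr nc" by (rule assms(2))
    then show "(\<Sum>j\<in>{0..<nc}. F s $$ (i, j) * x $ j) = (F s *\<^sub>v x) $ i"
      using i assms(3) by (simp add: scalar_prod_def)
  qed
  also have "\<dots> = vsum nr (\<lambda>s. F s *\<^sub>v x) I $ i"
    by (rule vsum_index[OF assms(1) i Fx, symmetric])
  finally show "(sum_mats nr nc F I *\<^sub>v x) $ i = vsum nr (\<lambda>s. F s *\<^sub>v x) I $ i" .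
qed

lemma energy_norm_square:
  assumes "0 \<le> bil B x x"
  shows "(energy_norm B x)\<^sup>2 = bil B x x"
  using assms unfolding energy_norm_def bil_def by simp

text \<open>An idempotent matrix with zero kernel is invertible, and cancelling one factor in
  \<open>P * P = P\<close> leaves the identity. This settles the uniqueness behind the definite
  description.\<close>

lemma orth_projection_trivial:
  assumes "A \<in> carrier_mat n n"
  shows "orth_projection n A {0\<^sub>v n} = 1\<^sub>m n"
  unfolding orth_projection_def
proof (rule the_equality)
  have "A *\<^sub>v 0\<^sub>v n = 0\<^sub>v n" using assms by (intro eq_vecI) auto
  then show "is_orth_projection n A {0\<^sub>v n} (1\<^sub>m n)"
    using assms unfolding is_orth_projection_def mat_kernel_def mat_range_def by auto
  fix P assume "is_orth_projection n A {0\<^sub>v n} P"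
  then have P: "P \<in> carrier_mat n n" "P * P = P" and ker: "mat_kernel P = {0\<^sub>v n}"
    unfolding is_orth_projection_def by auto
  obtain X where X: "X \<in> carrier_mat n n" "X * P = 1\<^sub>m n"
  proof (rule trivial_kernel_obtain_inverse[OF P(1)])
    fix v assume "v \<in> carrier_vec n" "P *\<^sub>v v = 0\<^sub>v n"
    then have "v \<in> mat_kernel P" using P unfolding mat_kernel_def by auto
    then show "v = 0\<^sub>v n" unfolding ker by simp
  qed
  have "P = (X * P) * P" using X(2) P(1) by simp
  also have "\<dots> = X * (P * P)" using X(1) P(1) by (simp add: assoc_mult_mat[of _ n n _ n _ n])
  finally show "P = 1\<^sub>m n" unfolding P(2) X(2) .
qed

lemma sharp_constant_nonsingular:
  assumes sharp: "sharp_constant n N ns R At A C" and A: "spd n A" and s: "s \<in> {1..N}"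
    and R: "R s \<in> carrier_mat (ns s) n" and At: "spd (ns s) (At s)" and x: "x \<in> carrier_vec (ns s)"
  shows "bil A ((R s)\<^sup>T *\<^sub>v x) ((R s)\<^sup>T *\<^sub>v x) \<le> inverse C * bil (At s) x x"
proof -
  have "mat_kernel (At s) = {0\<^sub>v (ns s)}"
  proof (intro equalityI subsetI)
    fix v assume "v \<in> mat_kernel (At s)"
    then have "v \<in> carrier_vec (ns s)" "At s *\<^sub>v v = 0\<^sub>v (ns s)"
      using spdD(1)[OF At] unfolding mat_kernel_def by auto
    then have "v = 0\<^sub>v (ns s)" by (intro spdD(5)[OF At]) (auto simp: bil_def)
    then show "v \<in> {0\<^sub>v (ns s)}" by simp
  qed (use spdD(1)[OF At] in \<open>auto simp: mat_kernel_def\<close>)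
  moreover have "(R s)\<^sup>T *\<^sub>v 0\<^sub>v (ns s) = 0\<^sub>v n" using R by (intro eq_vecI) auto
  ultimately have K: "(*\<^sub>v) ((R s)\<^sup>T) ` mat_kernel (At s) = {0\<^sub>v n}" by simp
  have Rx: "(R s)\<^sup>T *\<^sub>v x \<in> carrier_vec n" using R x by auto
  have "(energy_norm A
          (orth_projection n A ((*\<^sub>v) ((R s)\<^sup>T) ` mat_kernel (At s)) *\<^sub>v ((R s)\<^sup>T *\<^sub>v x)))\<^sup>2
        \<le> inverse C * (energy_norm (At s) x)\<^sup>2"
    using sharp s x unfolding sharp_constant_def by blast
  then have "(energy_norm A ((R s)\<^sup>T *\<^sub>v x))\<^sup>2 \<le> inverse C * (energy_norm (At s) x)\<^sup>2"
    unfolding K orth_projection_trivial[OF spdD(1)[OF A]] using Rx by simp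
  then show ?thesis
    unfolding energy_norm_square[OF spdD(4)[OF A Rx]] energy_norm_square[OF spdD(4)[OF At x]] .
qed

text \<open>Expand the nonnegative energy of \<open>u - K v\<close> and divide by \<open>K\<close>.
  The free weight \<open>K\<close> later becomes the stability constant.\<close>

lemma bil_young:
  assumes B: "spd m B" and u: "u \<in> carrier_vec m" and v: "v \<in> carrier_vec m" and K: "K > 0"
  shows "2 * bil B u v \<le> inverse K * bil B u u + K * bil B v v"
proof -
  note B1 = spdD(1)[OF B] and Bs = spdD(2)[OF B]
  have "0 \<le> bil B (u - K \<cdot>\<^sub>v v) (u - K \<cdot>\<^sub>v v)" using u v by (intro spdD(4)[OF B]) auto
  also have "\<dots> = bil B u u - 2 * K * bil B u v + K * K * bil B v v"
    using B1 u v bil_sym[OF B1 Bs v u]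
    by (simp add: bil_diff_left[of B m m] bil_diff_right[of B m m] bil_smult_left[of B m m]
        bil_smult_right[of B m m] algebra_simps)
  finally have "2 * K * bil B u v \<le> bil B u u + K * K * bil B v v" by simp
  then show ?thesis using K by (simp add: field_simps)
qed

lemma bil_add_le:
  assumes B: "spd m B" and u: "u \<in> carrier_vec m" and v: "v \<in> carrier_vec m"
  shows "bil B (u + v) (u + v) \<le> 2 * bil B u u + 2 * bil B v v"
  using bil_young[OF B u v, of 1] spdD(1)[OF B] u v bil_sym[OF spdD(1,2)[OF B] v u]
  by (simp add: bil_add_left[of B m m] bil_add_right[of B m m])

text \<open>Every mixed product is at most half the sum of the two energies, and in the double sum
  each energy then appears with total weight \<open>card J\<close>.\<close>

lemma bil_vsum_le_card:
  assumes B: "spd m B" and J: "finite J" "\<And>j. j \<in> J \<Longrightarrow> w j \<in> carrier_vec m"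
  shows "bil B (vsum m w J) (vsum m w J) \<le> real (card J) * (\<Sum>j\<in>J. bil B (w j) (w j))"
proof -
  define Q where "Q = (\<Sum>j\<in>J. bil B (w j) (w j) / 2)"
  have "bil B (vsum m w J) (vsum m w J) = (\<Sum>i\<in>J. \<Sum>j\<in>J. bil B (w i) (w j))"
    by (rule bil_vsum_vsum[OF spdD(1)[OF B] J(1,1,2,2)])
  also have "\<dots> \<le> (\<Sum>i\<in>J. \<Sum>j\<in>J. bil B (w i) (w i) / 2 + bil B (w j) (w j) / 2)"
  proof (intro sum_mono)
    fix i j assume "i \<in> J" "j \<in> J"
    then show "bil B (w i) (w j) \<le> bil B (w i) (w i) / 2 + bil B (w j) (w j) / 2"
      using bil_young[OF B J(2) J(2), of i j 1] by simp
  qed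
  also have "\<dots> = (\<Sum>i\<in>J. real (card J) * (bil B (w i) (w i) / 2) + Q)"
    by (simp add: sum.distrib Q_def)
  also have "\<dots> = real (card J) * (2 * Q)"
    by (simp add: sum.distrib Q_def sum_distrib_left)
  also have "2 * Q = (\<Sum>j\<in>J. bil B (w j) (w j))"
    unfolding Q_def sum_distrib_left by simp
  finally show ?thesis .
qed

lemma vsum_group:
  assumes "finite S" "finite T" "g ` S \<subseteq> T" "\<And>s. s \<in> S \<Longrightarrow> v s \<in> carrier_vec n"
  shows "vsum n v S = vsum n (\<lambda>j. vsum n v {s \<in> S. g s = j}) T"
proof (rule eq_vecI)
  have c: "vsum n v S \<in> carrier_vec n" by (rule vsum_closed[OF assms(4)])
  have cj: "vsum n v {s \<in> S. g s = j} \<in> carrier_vec n" for j by (rule vsum_closed) (use assms(4) in auto)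
  have c': "vsum n (\<lambda>j. vsum n v {s \<in> S. g s = j}) T \<in> carrier_vec n" by (rule vsum_closed[OF cj])
  show "dim_vec (vsum n v S) = dim_vec (vsum n (\<lambda>j. vsum n v {s \<in> S. g s = j}) T)"
    using c c' by simp
  fix i assume "i < dim_vec (vsum n (\<lambda>j. vsum n v {s \<in> S. g s = j}) T)"
  then have i: "i < n" using c' by simp
  have "vsum n (\<lambda>j. vsum n v {s \<in> S. g s = j}) T $ i = (\<Sum>j\<in>T. vsum n v {s \<in> S. g s = j} $ i)"
    by (rule vsum_index[OF assms(2) i cj])
  also have "\<dots> = (\<Sum>j\<in>T. \<Sum>s\<in>{s \<in> S. g s = j}. v s $ i)"
    by (intro sum.cong refl vsum_index i) (use assms(1,4) in auto)
  also have "\<dots> = (\<Sum>s\<in>S. v s $ i)" by (rule sum.group[OF assms(1-3)])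
  also have "\<dots> = vsum n v S $ i" by (rule vsum_index[OF assms(1) i assms(4), symmetric])
  finally show "vsum n v S $ i = vsum n (\<lambda>j. vsum n v {s \<in> S. g s = j}) T $ i" by simp
qed

text \<open>Within one color Pythagoras applies; the sum over the colors costs the factor
  \<open>Nc\<close>.\<close>

lemma coloring_bound:
  assumes A: "spd n A" and R: "\<And>s. s \<in> {1..N} \<Longrightarrow> R s \<in> carrier_mat (ns s) n"
    and col: "coloring_constant N ns R A Nc"
    and y: "\<And>s. s \<in> {1..N} \<Longrightarrow> y s \<in> carrier_vec (ns s)"
  shows "bil A (vsum n (\<lambda>s. (R s)\<^sup>T *\<^sub>v y s) {1..N}) (vsum n (\<lambda>s. (R s)\<^sup>T *\<^sub>v y s) {1..N})
    \<le> real Nc * (\<Sum>s=1..N. bil A ((R s)\<^sup>T *\<^sub>v y s) ((R s)\<^sup>T *\<^sub>v y s))"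
proof -
  note A1 = spdD(1)[OF A]
  define v where "v = (\<lambda>s. (R s)\<^sup>T *\<^sub>v y s)"
  have v: "v s \<in> carrier_vec n" if "s \<in> {1..N}" for s
    unfolding v_def using R[OF that] y[OF that] by (intro mult_mat_vec_carrier) simp_all
  obtain C where C: "{1..N} = (\<Union>j\<in>{1..Nc}. C j)"
    and orth: "\<And>j s t. j \<in> {1..Nc} \<Longrightarrow> s \<in> C j \<Longrightarrow> t \<in> C j \<Longrightarrow> s \<noteq> t \<Longrightarrow>
      R s * A * (R t)\<^sup>T = 0\<^sub>m (ns s) (ns t)"
    using col unfolding coloring_constant_def by (elim exE conjE) simp
  \<comment> \<open>Color classes may overlap. Choosing one color \<open>g s\<close> per subdomain
    replaces them by the disjoint fibers of \<open>g\<close>.\<close>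
  have "\<forall>s\<in>{1..N}. \<exists>j\<in>{1..Nc}. s \<in> C j" unfolding C by simp
  then obtain g where "\<forall>s\<in>{1..N}. g s \<in> {1..Nc} \<and> s \<in> C (g s)"
    unfolding Bex_def by (elim bchoice[THEN exE])
  then have g: "\<And>s. s \<in> {1..N} \<Longrightarrow> g s \<in> {1..Nc} \<and> s \<in> C (g s)" by simp
  define w where "w = (\<lambda>j. vsum n v {s \<in> {1..N}. g s = j})"
  have w: "w j \<in> carrier_vec n" for j unfolding w_def by (rule vsum_closed) (simp add: v)
  have o: "bil A (v s) (v t) = 0" if "s \<in> {1..N}" "t \<in> {1..N}" "g s = g t" "s \<noteq> t" for s t
  proof -
    have 0: "R s * A * (R t)\<^sup>T = 0\<^sub>m (ns s) (ns t)"
      using orth[of "g s" s t] g[OF that(1)] g[OF that(2)] that(3,4) by simp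
    have "bil A (v s) (v t) = y s \<bullet> (R s *\<^sub>v (A *\<^sub>v v t))"
      using transpose_vec_mult_scalar[OF R[OF that(1)], of "A *\<^sub>v v t" "y s"] y[OF that(1)] v[OF that(2)] A1
      unfolding bil_def by (simp add: v_def)
    also have "R s *\<^sub>v (A *\<^sub>v v t) = (R s * A * (R t)\<^sup>T) *\<^sub>v y t"
      using R[OF that(1)] R[OF that(2)] A1 y[OF that(2)] unfolding v_def
      by (simp add: assoc_mult_mat_vec[of _ "ns s" n _ "ns t"] assoc_mult_mat_vec[of _ "ns s" n _ n])
    also have "\<dots> = 0\<^sub>v (ns s)" unfolding 0 using y[OF that(2)] by (intro eq_vecI) auto
    finally show ?thesis using y[OF that(1)] by simp
  qed
  have ww: "bil A (w j) (w j) = (\<Sum>s\<in>{s \<in> {1..N}. g s = j}. bil A (v s) (v s))" for j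
    unfolding w_def by (rule bil_vsum_orthogonal[OF A1]) (use v o in auto)
  have z: "vsum n v {1..N} = vsum n w {1..Nc}"
    unfolding w_def by (rule vsum_group) (use g v in auto)
  have "bil A (vsum n w {1..Nc}) (vsum n w {1..Nc}) \<le> real (card {1..Nc}) * (\<Sum>j\<in>{1..Nc}. bil A (w j) (w j))"
    by (rule bil_vsum_le_card[OF A _ w]) simp
  also have "(\<Sum>j\<in>{1..Nc}. bil A (w j) (w j)) = (\<Sum>s\<in>{1..N}. bil A (v s) (v s))"
    unfolding ww by (rule sum.group) (use g in auto)
  finally show ?thesis unfolding z[symmetric] by (simp add: v_def)
qed

section \<open>Eigenvalue bounds\<close>

text \<open>The coarse space enters the eigenvalue bounds only through the \<open>A\<close>-orthogonal projection \<open>p\<close>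
  of \<open>x\<close> onto it, and the local solvers only through the solutions \<open>z s\<close> of the local problems.\<close>

locale schwarz =
  fixes n N :: nat and ns :: "nat \<Rightarrow> nat" and A :: "real mat" and R At :: "nat \<Rightarrow> real mat"
    and V0 :: "real vec set"
  assumes A: "spd n A"
    and R: "\<And>s. s \<in> {1..N} \<Longrightarrow> R s \<in> carrier_mat (ns s) n"
    and At: "\<And>s. s \<in> {1..N} \<Longrightarrow> spd (ns s) (At s)"
    and V0: "V0 \<subseteq> carrier_vec n" "0\<^sub>v n \<in> V0" "\<And>u v. u \<in> V0 \<Longrightarrow> v \<in> V0 \<Longrightarrow> u + v \<in> V0"
begin

lemmas A1 = spdD(1)[OF A] and As = spdD(2)[OF A]

definition glue :: "(nat \<Rightarrow> real vec) \<Rightarrow> real vec" where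
  "glue y = vsum n (\<lambda>s. (R s)\<^sup>T *\<^sub>v y s) {1..N}"

definition local_family :: "(nat \<Rightarrow> real vec) \<Rightarrow> bool" where
  "local_family y \<longleftrightarrow> (\<forall>s\<in>{1..N}. y s \<in> carrier_vec (ns s))"

lemma local_familyD: "local_family y \<Longrightarrow> s \<in> {1..N} \<Longrightarrow> y s \<in> carrier_vec (ns s)"
  unfolding local_family_def by simp

lemma extend_carrier: "s \<in> {1..N} \<Longrightarrow> x \<in> carrier_vec (ns s) \<Longrightarrow> (R s)\<^sup>T *\<^sub>v x \<in> carrier_vec n"
  using R[of s] by (intro mult_mat_vec_carrier) simp_all

lemma glue_carrier: "local_family y \<Longrightarrow> glue y \<in> carrier_vec n"
  unfolding glue_def by (rule vsum_closed) (rule extend_carrier, simp_all add: local_familyD)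

definition projects :: "real vec \<Rightarrow> real vec \<Rightarrow> bool" where
  "projects x p \<longleftrightarrow> x \<in> carrier_vec n \<and> p \<in> V0 \<and> (\<forall>u\<in>V0. bil A u p = bil A u x)"

text \<open>The equation \<open>H A x = lam x\<close> in terms of vectors: \<open>glue z\<close> is
  the one-level part of \<open>H\<close> applied to \<open>A x\<close>, and \<open>p\<close> is the
  coarse part.\<close>

definition eigenpair :: "real \<Rightarrow> real vec \<Rightarrow> real vec \<Rightarrow> (nat \<Rightarrow> real vec) \<Rightarrow> bool" where
  "eigenpair lam x p z \<longleftrightarrow> projects x p \<and> x \<noteq> 0\<^sub>v n \<and> local_family z \<and>
     (\<forall>s\<in>{1..N}. At s *\<^sub>v z s = R s *\<^sub>v (A *\<^sub>v x)) \<and> glue z + p = lam \<cdot>\<^sub>v x"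

text \<open>Moving \<open>R s\<close> across the product produces the local right-hand sides, which
  the local equations turn into \<open>At s *\<^sub>v z s\<close>.\<close>

lemma bil_glue:
  assumes x: "x \<in> carrier_vec n" and z: "local_family z"
    and loc: "\<And>s. s \<in> {1..N} \<Longrightarrow> At s *\<^sub>v z s = R s *\<^sub>v (A *\<^sub>v x)" and y: "local_family y"
  shows "bil A (glue y) x = (\<Sum>s=1..N. bil (At s) (y s) (z s))"
proof -
  have "bil A (glue y) x = (\<Sum>s=1..N. bil A ((R s)\<^sup>T *\<^sub>v y s) x)"
    unfolding glue_def
    by (rule bil_vsum_left[OF A1 x]) (simp_all add: extend_carrier local_familyD[OF y])
  also have "\<dots> = (\<Sum>s=1..N. bil (At s) (y s) (z s))"
  proof (rule sum.cong[OF refl])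
    fix s assume s: "s \<in> {1..N}"
    have "bil A ((R s)\<^sup>T *\<^sub>v y s) x = y s \<bullet> (R s *\<^sub>v (A *\<^sub>v x))"
      using transpose_vec_mult_scalar[OF R[OF s], of "A *\<^sub>v x" "y s"] local_familyD[OF y s] A1 x
      unfolding bil_def by simp
    then show "bil A ((R s)\<^sup>T *\<^sub>v y s) x = bil (At s) (y s) (z s)"
      unfolding bil_def loc[OF s] .
  qed
  finally show ?thesis .
qed

lemma eigenpair_energy:
  assumes "eigenpair lam x p z"
  shows "bil A (glue z) x = (\<Sum>s=1..N. bil (At s) (z s) (z s))"
    and "lam * bil A x x = (\<Sum>s=1..N. bil (At s) (z s) (z s)) + bil A p p"
proof -
  have x: "x \<in> carrier_vec n" and p: "p \<in> V0" and pp: "bil A p p = bil A p x" and z: "local_family z"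
    and loc: "\<And>s. s \<in> {1..N} \<Longrightarrow> At s *\<^sub>v z s = R s *\<^sub>v (A *\<^sub>v x)" and eq: "glue z + p = lam \<cdot>\<^sub>v x"
    using assms unfolding eigenpair_def projects_def by auto
  show gz: "bil A (glue z) x = (\<Sum>s=1..N. bil (At s) (z s) (z s))"
    by (rule bil_glue[OF x z loc z])
  have "lam * bil A x x = bil A (glue z + p) x"
    unfolding eq bil_smult_left[OF A1 x x] ..
  also have "\<dots> = bil A (glue z) x + bil A p x"
    by (rule bil_add_left[OF A1 glue_carrier[OF z] _ x]) (use p V0 in blast)
  finally show "lam * bil A x x = (\<Sum>s=1..N. bil (At s) (z s) (z s)) + bil A p p"
    unfolding gz pp .
qed

text \<open>Since \<open>S\<close> is the \<open>A\<close>-product of \<open>glue z\<close> and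
  \<open>x\<close>, Young's inequality with weight \<open>c\<close> and stability give
  \<open>2 * S \<le> S + c * D\<close>. The coarse projection adds at most \<open>D\<close>.\<close>

lemma eigenvalue_le:
  assumes eig: "eigenpair lam x p z" and c: "c \<ge> 0"
    and stable: "\<And>y. local_family y \<Longrightarrow> bil A (glue y) (glue y) \<le> c * (\<Sum>s=1..N. bil (At s) (y s) (y s))"
  shows "lam \<le> c + 1"
proof -
  have x: "x \<in> carrier_vec n" "x \<noteq> 0\<^sub>v n" and p: "p \<in> V0" and pp: "bil A p p = bil A p x"
    and z: "local_family z"
    using eig unfolding eigenpair_def projects_def by auto
  have pc: "p \<in> carrier_vec n" using p V0 by blast
  have G: "glue z \<in> carrier_vec n" by (rule glue_carrier[OF z])
  define D where "D = bil A x x"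
  define S where "S = (\<Sum>s=1..N. bil (At s) (z s) (z s))"
  have D: "D > 0" unfolding D_def by (rule spdD(3)[OF A x])
  have gz: "bil A (glue z) x = S" and lD: "lam * D = S + bil A p p"
    using eigenpair_energy[OF eig] unfolding S_def D_def by auto
  have "bil A p p \<le> D"
    using bil_young[OF A pc x(1), of 1] pp unfolding D_def by simp
  \<comment> \<open>The weight \<open>c\<close> must be positive in Young's inequality. For
    \<open>c = 0\<close> stability makes \<open>glue z\<close> vanish, and \<open>S\<close> with
    it.\<close>
  moreover have "S \<le> c * D"
  proof (cases "c = 0")
    case True
    then have "glue z = 0\<^sub>v n" using stable[OF z] by (intro spdD(5)[OF A G]) simp
    then have "S = 0" using A1 x(1) unfolding gz[symmetric] bil_def by simp
    then show ?thesis using True by simp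
  next
    case False
    then have c0: "c > 0" using c by simp
    have "2 * S \<le> inverse c * bil A (glue z) (glue z) + c * D"
      using bil_young[OF A G x(1) c0] unfolding gz D_def .
    also have "inverse c * bil A (glue z) (glue z) \<le> inverse c * (c * S)"
      using stable[OF z] c0 unfolding S_def by (intro mult_left_mono) auto
    also have "inverse c * (c * S) = S" using c0 by simp
    finally show ?thesis by simp
  qed
  ultimately have "lam * D \<le> (c + 1) * D" unfolding lD by (simp add: algebra_simps)
  then show ?thesis using D by simp
qed

text \<open>The classical stable decomposition argument (Lions' lemma). Pair the decomposition with
  \<open>x\<close> and apply Young's inequality with weight \<open>K\<close> to every term: the
  decomposition contributes at most \<open>D\<close> and the solutions \<open>K * lam * D\<close>,
  so \<open>2 * D \<le> D + K * lam * D\<close>.\<close>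

lemma eigenvalue_ge:
  assumes eig: "eigenpair lam x p z" and K: "K > 0"
    and u: "u \<in> V0" and g: "local_family g" and dec: "x = u + glue g"
    and stable: "bil A u u + (\<Sum>s=1..N. bil (At s) (g s) (g s)) \<le> K * bil A x x"
  shows "inverse K \<le> lam"
proof -
  have x: "x \<in> carrier_vec n" "x \<noteq> 0\<^sub>v n" and p: "p \<in> V0" and up: "bil A u p = bil A u x"
    and z: "local_family z" and loc: "\<And>s. s \<in> {1..N} \<Longrightarrow> At s *\<^sub>v z s = R s *\<^sub>v (A *\<^sub>v x)"
    using eig u unfolding eigenpair_def projects_def by auto
  have pc: "p \<in> carrier_vec n" "u \<in> carrier_vec n" using p u V0 by blast+
  define D where "D = bil A x x"
  have D: "D > 0" unfolding D_def by (rule spdD(3)[OF A x])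
  have lD: "lam * D = (\<Sum>s=1..N. bil (At s) (z s) (z s)) + bil A p p"
    using eigenpair_energy(2)[OF eig] unfolding D_def .
  have gz: "bil A (glue g) x = (\<Sum>s=1..N. bil (At s) (g s) (z s))" by (rule bil_glue[OF x(1) z loc g])
  have "D = bil A (u + glue g) x" unfolding D_def dec[symmetric] ..
  also have "\<dots> = bil A u p + (\<Sum>s=1..N. bil (At s) (g s) (z s))"
    unfolding bil_add_left[OF A1 pc(2) glue_carrier[OF g] x(1)] up gz ..
  finally have "2 * D = 2 * bil A u p + (\<Sum>s=1..N. 2 * bil (At s) (g s) (z s))"
    by (simp add: sum_distrib_left)
  also have "\<dots> \<le> (inverse K * bil A u u + K * bil A p p) +
      (\<Sum>s=1..N. inverse K * bil (At s) (g s) (g s) + K * bil (At s) (z s) (z s))"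
    by (intro add_mono sum_mono bil_young[OF A pc(2,1) K] bil_young[OF At _ _ K])
      (simp_all add: local_familyD[OF g] local_familyD[OF z])
  also have "\<dots> = inverse K * (bil A u u + (\<Sum>s=1..N. bil (At s) (g s) (g s))) + K * (lam * D)"
    unfolding lD by (simp add: sum.distrib sum_distrib_left distrib_left)
  also have "inverse K * (bil A u u + (\<Sum>s=1..N. bil (At s) (g s) (g s))) \<le> inverse K * (K * D)"
    using stable K unfolding D_def by (intro mult_left_mono) auto
  also have "inverse K * (K * D) = D" using K by simp
  finally have "1 * D \<le> (K * lam) * D" by simp
  then have "1 \<le> K * lam" using D by (simp only: mult_le_cancel_right_pos)
  then show ?thesis using K by (simp add: field_simps)
qed

text \<open>Splitting only the component \<open>w\<close> of \<open>x\<close> that is \<open>A\<close>-orthogonal to the coarse space, and not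
  \<open>x\<close> itself, is what yields a product of two maxima.\<close>

lemma coarse_stable_splitting:
  assumes proj: "projects x p" and \<tau>: "\<tau> > 0" and Nhat: "Nhat > 0" and c: "c \<ge> 0"
    and split: "splitting n N ns R A M Nhat"
    and good: "\<And>s y. s \<in> {1..N} \<Longrightarrow> y \<in> carrier_vec (ns s) \<Longrightarrow> \<exists>g b. g \<in> carrier_vec (ns s) \<and>
        b \<in> carrier_vec (ns s) \<and> y = g + b \<and> (R s)\<^sup>T *\<^sub>v b \<in> V0 \<and>
        bil (At s) g g \<le> \<tau> * bil (M s) y y \<and> Q s g"
    and stable: "\<And>g. local_family g \<Longrightarrow> (\<And>s. s \<in> {1..N} \<Longrightarrow> Q s (g s)) \<Longrightarrow>
        bil A (glue g) (glue g) \<le> c * (\<Sum>s=1..N. bil (At s) (g s) (g s))"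
  obtains u g where "u \<in> V0" "local_family g" "x = u + glue g"
    "bil A u u + (\<Sum>s=1..N. bil (At s) (g s) (g s))
      \<le> (max 2 (1 + 2 * c) * max 1 (Nhat * \<tau>)) * bil A x x"
proof -
  have x: "x \<in> carrier_vec n" and p: "p \<in> V0" and orth: "\<And>u. u \<in> V0 \<Longrightarrow> bil A u p = bil A u x"
    using proj unfolding projects_def by auto
  have pc: "p \<in> carrier_vec n" using p V0 by blast
  define w where "w = x - p"
  have w: "w \<in> carrier_vec n" unfolding w_def using x pc by auto
  have xw: "x = p + w" unfolding w_def using x pc by (intro eq_vecI) auto
  have uw: "bil A u w = 0" if "u \<in> V0" for u
    using orth[OF that] bil_diff_right[OF A1 _ x pc, of u] that V0 unfolding w_def by auto
  obtain y where y: "local_family y" "w = glue y"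
    "(\<Sum>s=1..N. bil (M s) (y s) (y s)) \<le> Nhat * bil A w w"
    using split w unfolding splitting_def local_family_def glue_def bil_def by blast
  \<comment> \<open>Pairing the good and the bad part lets a single choice function select
    both.\<close>
  have "\<forall>s. \<exists>gb. s \<in> {1..N} \<longrightarrow> fst gb \<in> carrier_vec (ns s) \<and>
        snd gb \<in> carrier_vec (ns s) \<and> y s = fst gb + snd gb \<and> (R s)\<^sup>T *\<^sub>v snd gb \<in> V0 \<and>
        bil (At s) (fst gb) (fst gb) \<le> \<tau> * bil (M s) (y s) (y s) \<and> Q s (fst gb)"
    using good[OF _ local_familyD[OF y(1)]] by (metis fst_conv snd_conv)
  then obtain gb where gb: "\<And>s. s \<in> {1..N} \<Longrightarrow> fst (gb s) \<in> carrier_vec (ns s) \<and>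
        snd (gb s) \<in> carrier_vec (ns s) \<and> y s = fst (gb s) + snd (gb s) \<and> (R s)\<^sup>T *\<^sub>v snd (gb s) \<in> V0 \<and>
        bil (At s) (fst (gb s)) (fst (gb s)) \<le> \<tau> * bil (M s) (y s) (y s) \<and> Q s (fst (gb s))"
    by metis
  define g where "g = (\<lambda>s. fst (gb s))"
  define b where "b = (\<lambda>s. snd (gb s))"
  have gs: "g s \<in> carrier_vec (ns s) \<and> b s \<in> carrier_vec (ns s) \<and> y s = g s + b s \<and>
      (R s)\<^sup>T *\<^sub>v b s \<in> V0 \<and> bil (At s) (g s) (g s) \<le> \<tau> * bil (M s) (y s) (y s) \<and> Q s (g s)"
    if "s \<in> {1..N}" for s
    using gb[OF that] unfolding g_def b_def .
  have g: "local_family g" and b: "local_family b"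
    and bV: "\<And>s. s \<in> {1..N} \<Longrightarrow> (R s)\<^sup>T *\<^sub>v b s \<in> V0" and Q: "\<And>s. s \<in> {1..N} \<Longrightarrow> Q s (g s)"
    and ygb: "\<And>s. s \<in> {1..N} \<Longrightarrow> y s = g s + b s"
    and gM: "\<And>s. s \<in> {1..N} \<Longrightarrow> bil (At s) (g s) (g s) \<le> \<tau> * bil (M s) (y s) (y s)"
    using gs unfolding local_family_def by blast+
  define v where "v = glue b"
  define G where "G = glue g"
  define S where "S = (\<Sum>s=1..N. bil (At s) (g s) (g s))"
  have G: "G \<in> carrier_vec n" unfolding G_def by (rule glue_carrier[OF g])
  have vV: "v \<in> V0"
    unfolding v_def glue_def
    by (rule vsum_induct) (use bV V0 extend_carrier local_familyD[OF b] in auto)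
  then have v: "v \<in> carrier_vec n" using V0 by blast
  have wGv: "w = G + v"
  proof -
    have "glue y = vsum n (\<lambda>s. (R s)\<^sup>T *\<^sub>v g s + (R s)\<^sup>T *\<^sub>v b s) {1..N}"
      unfolding glue_def
    proof (rule vsum_cong)
      fix s assume s: "s \<in> {1..N}"
      have RT: "(R s)\<^sup>T \<in> carrier_mat n (ns s)" using R[OF s] by simp
      show "(R s)\<^sup>T *\<^sub>v y s = (R s)\<^sup>T *\<^sub>v g s + (R s)\<^sup>T *\<^sub>v b s"
        unfolding ygb[OF s]
        by (rule mult_add_distrib_mat_vec[OF RT local_familyD[OF g s] local_familyD[OF b s]])
      show "(R s)\<^sup>T *\<^sub>v g s + (R s)\<^sup>T *\<^sub>v b s \<in> carrier_vec n"
        using extend_carrier[OF s local_familyD[OF g s]] extend_carrier[OF s local_familyD[OF b s]]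
        by simp
    qed simp
    also have "\<dots> = G + v"
      unfolding G_def v_def glue_def
      by (rule vsum_add) (simp_all add: extend_carrier local_familyD[OF g] local_familyD[OF b])
    finally show ?thesis unfolding y(2) .
  qed
  \<comment> \<open>\<open>v\<close> is minus the \<open>A\<close>-orthogonal projection of \<open>G\<close> onto the coarse space.\<close>
  have vG: "bil A v v \<le> bil A G G"
  proof -
    have "bil A v G + bil A v v = 0" using uw[OF vV] unfolding wGv bil_add_right[OF A1 v G v] .
    moreover have "0 \<le> bil A (G + v) (G + v)" using G v by (intro spdD(4)[OF A]) auto
    ultimately show ?thesis
      using G v A1 bil_sym[OF A1 As G v]
      by (simp add: bil_add_left[of A n n] bil_add_right[of A n n])
  qed
  have S: "S \<le> Nhat * \<tau> * bil A w w"
  proof -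
    have "S \<le> (\<Sum>s=1..N. \<tau> * bil (M s) (y s) (y s))" unfolding S_def by (intro sum_mono gM)
    also have "\<dots> = \<tau> * (\<Sum>s=1..N. bil (M s) (y s) (y s))" by (simp add: sum_distrib_left)
    also have "\<dots> \<le> \<tau> * (Nhat * bil A w w)" using y(3) \<tau> by (intro mult_left_mono) auto
    finally show ?thesis by (simp add: mult_ac)
  qed
  have GS: "bil A G G \<le> c * S" unfolding G_def S_def by (rule stable[OF g Q])
  define u where "u = p + v"
  define P where "P = bil A p p"
  define W where "W = bil A w w"
  have PW: "P \<ge> 0" "W \<ge> 0" unfolding P_def W_def using spdD(4)[OF A] pc w by auto
  have xx: "bil A x x = P + W"
    using uw[OF p] bil_sym[OF A1 As w pc] A1 pc w unfolding xw P_def W_def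
    by (simp add: bil_add_left[of A n n] bil_add_right[of A n n])
  \<comment> \<open>The coarse vector \<open>p + v\<close> costs \<open>2 * P\<close> plus twice the
    energy of \<open>v\<close>, hence \<open>2 * c * S\<close>; the local energy adds one more
    \<open>S\<close>.\<close>
  have "bil A u u + S \<le> 2 * P + (1 + 2 * c) * S"
    using bil_add_le[OF A pc v] vG GS unfolding u_def P_def by (simp add: algebra_simps)
  also have "\<dots> \<le> 2 * P + (1 + 2 * c) * (Nhat * \<tau> * W)"
    using S c unfolding W_def by (intro add_left_mono mult_left_mono) auto
  \<comment> \<open>\<open>P\<close> and \<open>W\<close> add up to the energy of \<open>x\<close>,
    so one factor dominating both coefficients \<open>2\<close> and
    \<open>(1 + 2 * c) * (Nhat * \<tau>)\<close> suffices.\<close>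
  also have "\<dots> \<le> (max 2 (1 + 2 * c) * max 1 (Nhat * \<tau>)) * P + (max 2 (1 + 2 * c) * max 1 (Nhat * \<tau>)) * W"
  proof (rule add_mono)
    have "2 * 1 \<le> max 2 (1 + 2 * c) * max 1 (Nhat * \<tau>)" by (intro mult_mono) auto
    then show "2 * P \<le> (max 2 (1 + 2 * c) * max 1 (Nhat * \<tau>)) * P"
      using PW(1) by (intro mult_right_mono) auto
    have "(1 + 2 * c) * (Nhat * \<tau>) \<le> max 2 (1 + 2 * c) * max 1 (Nhat * \<tau>)"
      using \<tau> Nhat by (intro mult_mono) auto
    then have "(1 + 2 * c) * (Nhat * \<tau>) * W \<le> (max 2 (1 + 2 * c) * max 1 (Nhat * \<tau>)) * W"
      using PW(2) by (intro mult_right_mono) auto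
    then show "(1 + 2 * c) * (Nhat * \<tau> * W) \<le> (max 2 (1 + 2 * c) * max 1 (Nhat * \<tau>)) * W"
      by (simp only: mult.assoc)
  qed
  finally have est: "bil A u u + S \<le> (max 2 (1 + 2 * c) * max 1 (Nhat * \<tau>)) * bil A x x"
    unfolding xx by (simp only: distrib_left)
  have "x = u + G" unfolding u_def xw wGv using pc G v by (intro eq_vecI) auto
  moreover have "u \<in> V0" unfolding u_def by (rule V0(3)[OF p vV])
  ultimately show ?thesis using that[of u g] g est unfolding G_def S_def by simp
qed

text \<open>Common to both GenEO variants. \<open>Q\<close> passes on what stability requires of the
  good parts: nothing for GenEO, the bound with \<open>inverse \<upsilon>\<close> for double
  GenEO.\<close>

lemma eigenvalue_ge_geneo:
  assumes eig: "eigenpair lam x p z" and \<tau>: "\<tau> > 0" and c: "c \<ge> 0"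
    and split: "splitting n N ns R A M Nhat"
    and good: "\<And>s y. s \<in> {1..N} \<Longrightarrow> y \<in> carrier_vec (ns s) \<Longrightarrow> \<exists>g b. g \<in> carrier_vec (ns s) \<and>
        b \<in> carrier_vec (ns s) \<and> y = g + b \<and> (R s)\<^sup>T *\<^sub>v b \<in> V0 \<and>
        bil (At s) g g \<le> \<tau> * bil (M s) y y \<and> Q s g"
    and stable: "\<And>g. local_family g \<Longrightarrow> (\<And>s. s \<in> {1..N} \<Longrightarrow> Q s (g s)) \<Longrightarrow>
        bil A (glue g) (glue g) \<le> c * (\<Sum>s=1..N. bil (At s) (g s) (g s))"
  shows "inverse (max 2 (1 + 2 * c) * max 1 (Nhat * \<tau>)) \<le> lam"
proof -
  have proj: "projects x p" using eig unfolding eigenpair_def by simp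
  have Nhat: "Nhat > 0" using split unfolding splitting_def by simp
  obtain u g where ug: "u \<in> V0" "local_family g" "x = u + glue g"
    "bil A u u + (\<Sum>s=1..N. bil (At s) (g s) (g s))
      \<le> (max 2 (1 + 2 * c) * max 1 (Nhat * \<tau>)) * bil A x x"
    by (rule coarse_stable_splitting[OF proj \<tau> Nhat c split good stable])
  have "max 2 (1 + 2 * c) * max 1 (Nhat * \<tau>) > 0" by (intro mult_pos_pos) auto
  from eigenvalue_ge[OF eig this ug] show ?thesis .
qed

end

section \<open>From the matrix operators to eigenpairs and stability\<close>

context schwarz
begin

text \<open>Galerkin's principle: injectivity makes the coarse matrix spd, and its inverse is chosen
  so that the correction and \<open>x\<close> have the same image under \<open>R0 * A\<close>.
  Testing with coarse vectors yields the projection property.\<close>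

lemma coarse_correction:
  assumes R0: "R0 \<in> carrier_mat k n" and V: "V0 = mat_range (R0\<^sup>T)"
    and inj: "\<And>c. c \<in> carrier_vec k \<Longrightarrow> R0\<^sup>T *\<^sub>v c = 0\<^sub>v n \<Longrightarrow> c = 0\<^sub>v k"
    and x: "x \<in> carrier_vec n"
  defines "P \<equiv> R0\<^sup>T * the (mat_inverse (R0 * A * R0\<^sup>T)) * R0"
  shows "P \<in> carrier_mat n n" "projects x (P *\<^sub>v (A *\<^sub>v x))"
proof -
  define E where "E = R0 * A * R0\<^sup>T"
  have RT: "R0\<^sup>T \<in> carrier_mat n k" using R0 by simp
  have "spd k E" using congruence_spd[OF A RT inj] unfolding E_def by simp
  note E = spdD(1)[OF this]
  obtain X where X: "X \<in> carrier_mat k k" "E * X = 1\<^sub>m k" "mat_inverse E = Some X"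
    using spd_obtain_inverse[OF \<open>spd k E\<close>] by metis
  have P: "P = R0\<^sup>T * X * R0" using X(3) unfolding P_def E_def by simp
  show "P \<in> carrier_mat n n" unfolding P using R0 X(1) by simp
  define r where "r = R0 *\<^sub>v (A *\<^sub>v x)"
  define q where "q = X *\<^sub>v r"
  have Ax: "A *\<^sub>v x \<in> carrier_vec n" by (rule mult_mat_vec_carrier[OF A1 x])
  have r: "r \<in> carrier_vec k" unfolding r_def by (rule mult_mat_vec_carrier[OF R0 Ax])
  have q: "q \<in> carrier_vec k" unfolding q_def by (rule mult_mat_vec_carrier[OF X(1) r])
  have p: "P *\<^sub>v (A *\<^sub>v x) = R0\<^sup>T *\<^sub>v q"
  proof -
    have "P *\<^sub>v (A *\<^sub>v x) = (R0\<^sup>T * X) *\<^sub>v r"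
      unfolding P r_def by (rule assoc_mult_mat_vec[OF _ R0 Ax]) (rule mult_carrier_mat[OF RT X(1)])
    also have "\<dots> = R0\<^sup>T *\<^sub>v q" unfolding q_def by (rule assoc_mult_mat_vec[OF RT X(1) r])
    finally show ?thesis .
  qed
  have pc: "R0\<^sup>T *\<^sub>v q \<in> carrier_vec n" by (rule mult_mat_vec_carrier[OF RT q])
  have res: "R0 *\<^sub>v (A *\<^sub>v (R0\<^sup>T *\<^sub>v q)) = r"
  proof -
    have "R0 *\<^sub>v (A *\<^sub>v (R0\<^sup>T *\<^sub>v q)) = (R0 * A) *\<^sub>v (R0\<^sup>T *\<^sub>v q)"
      by (rule assoc_mult_mat_vec[OF R0 A1 pc, symmetric])
    also have "\<dots> = E *\<^sub>v q" unfolding E_def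
      by (rule assoc_mult_mat_vec[OF mult_carrier_mat[OF R0 A1] RT q, symmetric])
    also have "\<dots> = (E * X) *\<^sub>v r" unfolding q_def by (rule assoc_mult_mat_vec[OF E X(1) r, symmetric])
    finally show ?thesis unfolding X(2) using r by simp
  qed
  have "bil A u (R0\<^sup>T *\<^sub>v q) = bil A u x" if u: "u \<in> V0" for u
  proof -
    obtain c where c: "c \<in> carrier_vec k" "u = R0\<^sup>T *\<^sub>v c"
      using u R0 unfolding V mat_range_def by auto
    have "bil A u v = c \<bullet> (R0 *\<^sub>v (A *\<^sub>v v))" if "v \<in> carrier_vec n" for v
      unfolding bil_def c(2)
      by (rule transpose_vec_mult_scalar[OF R0 mult_mat_vec_carrier[OF A1 that] c(1)])
    then show ?thesis using pc x res unfolding r_def by simp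
  qed
  moreover have "R0\<^sup>T *\<^sub>v q \<in> V0" unfolding V mat_range_def using R0 q by auto
  ultimately show "projects x (P *\<^sub>v (A *\<^sub>v x))" unfolding projects_def p using x by simp
qed

lemma one_level_mult_vec:
  assumes inv: "\<And>s. s \<in> {1..N} \<Longrightarrow> invertible_mat (At s)" and v: "v \<in> carrier_vec n"
  obtains z where "local_family z" "\<And>s. s \<in> {1..N} \<Longrightarrow> At s *\<^sub>v z s = R s *\<^sub>v v"
    "one_level n N R At *\<^sub>v v = glue z"
proof -
  define z where "z = (\<lambda>s. pinv (At s) *\<^sub>v (R s *\<^sub>v v))"
  have X: "pinv (At s) \<in> carrier_mat (ns s) (ns s)" "At s * pinv (At s) = 1\<^sub>m (ns s)"
    if "s \<in> {1..N}" for s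
    by (rule pinv_invertible[OF spdD(1)[OF At[OF that]] inv[OF that]])+
  have Rv: "R s *\<^sub>v v \<in> carrier_vec (ns s)" if "s \<in> {1..N}" for s
    by (rule mult_mat_vec_carrier[OF R[OF that] v])
  have RT: "(R s)\<^sup>T \<in> carrier_mat n (ns s)" if "s \<in> {1..N}" for s using R[OF that] by simp
  show ?thesis
  proof (rule that)
    show z: "local_family z"
      unfolding local_family_def z_def using mult_mat_vec_carrier[OF X(1) Rv] by blast
    show "At s *\<^sub>v z s = R s *\<^sub>v v" if "s \<in> {1..N}" for s
      using assoc_mult_mat_vec[OF spdD(1)[OF At[OF that]] X(1)[OF that] Rv[OF that]] X(2)[OF that] Rv[OF that]
      unfolding z_def by simp
    have F: "(R s)\<^sup>T * pinv (At s) * R s \<in> carrier_mat n n" if "s \<in> {1..N}" for s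
      by (rule mult_carrier_mat[OF mult_carrier_mat[OF RT[OF that] X(1)[OF that]] R[OF that]])
    have "one_level n N R At *\<^sub>v v = vsum n (\<lambda>s. ((R s)\<^sup>T * pinv (At s) * R s) *\<^sub>v v) {1..N}"
      unfolding one_level_def by (rule sum_mats_mult_vec[OF _ F v]) simp
    also have "\<dots> = glue z"
      unfolding glue_def
    proof (rule vsum_cong)
      fix s assume s: "s \<in> {1..N}"
      show "((R s)\<^sup>T * pinv (At s) * R s) *\<^sub>v v = (R s)\<^sup>T *\<^sub>v z s"
        unfolding z_def assoc_mult_mat_vec[OF mult_carrier_mat[OF RT[OF s] X(1)[OF s]] R[OF s] v]
        by (rule assoc_mult_mat_vec[OF RT[OF s] X(1)[OF s] Rv[OF s]])
      show "(R s)\<^sup>T *\<^sub>v z s \<in> carrier_vec n" by (rule extend_carrier[OF s local_familyD[OF z s]])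
    qed simp
    finally show "one_level n N R At *\<^sub>v v = glue z" .
  qed
qed

lemma eigenvalue_eigenpair:
  assumes R0: "R0 \<in> carrier_mat k n" and V: "V0 = mat_range (R0\<^sup>T)"
    and inj: "\<And>c. c \<in> carrier_vec k \<Longrightarrow> R0\<^sup>T *\<^sub>v c = 0\<^sub>v n \<Longrightarrow> c = 0\<^sub>v k"
    and inv: "\<And>s. s \<in> {1..N} \<Longrightarrow> invertible_mat (At s)"
    and ev: "eigenvalue (two_level_additive n N R At A R0 * A) lam"
  obtains x p z where "eigenpair lam x p z"
proof -
  define P where "P = R0\<^sup>T * the (mat_inverse (R0 * A * R0\<^sup>T)) * R0"
  have H: "one_level n N R At \<in> carrier_mat n n" by (simp add: one_level_def sum_mats_def)
  have P: "P \<in> carrier_mat n n"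
    unfolding P_def by (rule coarse_correction(1)[OF R0 V inj zero_carrier_vec])
  have HP: "two_level_additive n N R At A R0 = one_level n N R At + P"
    unfolding two_level_additive_def P_def ..
  have HPc: "one_level n N R At + P \<in> carrier_mat n n" using P by simp
  obtain x where x: "x \<in> carrier_vec n" "x \<noteq> 0\<^sub>v n"
    and eq: "((one_level n N R At + P) * A) *\<^sub>v x = lam \<cdot>\<^sub>v x"
    using ev carrier_matD(1)[OF HPc] unfolding HP eigenvalue_def eigenvector_def index_mult_mat by auto
  have Ax: "A *\<^sub>v x \<in> carrier_vec n" by (rule mult_mat_vec_carrier[OF A1 x(1)])
  have pr: "projects x (P *\<^sub>v (A *\<^sub>v x))"
    unfolding P_def by (rule coarse_correction(2)[OF R0 V inj x(1)])
  obtain z where z: "local_family z" "\<And>s. s \<in> {1..N} \<Longrightarrow> At s *\<^sub>v z s = R s *\<^sub>v (A *\<^sub>v x)"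
    "one_level n N R At *\<^sub>v (A *\<^sub>v x) = glue z"
    using one_level_mult_vec[OF inv Ax] by blast
  have "glue z + P *\<^sub>v (A *\<^sub>v x) = lam \<cdot>\<^sub>v x"
    unfolding z(3)[symmetric] add_mult_distrib_mat_vec[OF H P Ax, symmetric]
      assoc_mult_mat_vec[OF HPc A1 x(1), symmetric] by (rule eq)
  then have "eigenpair lam x (P *\<^sub>v (A *\<^sub>v x)) z"
    unfolding eigenpair_def using pr x z by blast
  then show ?thesis by (rule that)
qed

text \<open>Separates the two sources of the stability constant. The local factor \<kappa> is
  \<open>inverse Csharp\<close> or \<open>inverse \<upsilon>\<close>.\<close>

lemma colored_stability:
  assumes col: "coloring_constant N ns R A Nc" and g: "local_family g"
    and loc: "\<And>s. s \<in> {1..N} \<Longrightarrow>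
      bil A ((R s)\<^sup>T *\<^sub>v g s) ((R s)\<^sup>T *\<^sub>v g s) \<le> \<kappa> * bil (At s) (g s) (g s)"
  shows "bil A (glue g) (glue g) \<le> real Nc * \<kappa> * (\<Sum>s=1..N. bil (At s) (g s) (g s))"
proof -
  have "bil A (glue g) (glue g) \<le> real Nc * (\<Sum>s=1..N. bil A ((R s)\<^sup>T *\<^sub>v g s) ((R s)\<^sup>T *\<^sub>v g s))"
    unfolding glue_def by (rule coloring_bound[where R = R and y = g, OF A R col local_familyD[OF g]])
  also have "\<dots> \<le> real Nc * (\<Sum>s=1..N. \<kappa> * bil (At s) (g s) (g s))"
    by (intro mult_left_mono sum_mono loc) auto
  finally show ?thesis by (simp add: sum_distrib_left mult.assoc)
qed

text \<open>The local vectors are \<open>D s *\<^sub>v (R s *\<^sub>v x)\<close>; applying the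
  partition of unity to \<open>x\<close> shows that they glue to \<open>x\<close>.\<close>

lemma pou_splitting_imp_splitting:
  assumes "pou_splitting n N ns R A M Nhat"
  shows "splitting n N ns R A M Nhat"
proof -
  obtain D where M: "\<forall>s\<in>{1..N}. spsd (ns s) (M s)" "0 < Nhat"
    and D: "\<And>s. s \<in> {1..N} \<Longrightarrow> spd (ns s) (D s)"
    and one: "1\<^sub>m n = sum_mats n n (\<lambda>s. (R s)\<^sup>T * D s * R s) {1..N}"
    and le: "\<And>x. x \<in> carrier_vec n \<Longrightarrow>
           (\<Sum>s=1..N. (D s *\<^sub>v (R s *\<^sub>v x)) \<bullet> (M s *\<^sub>v (D s *\<^sub>v (R s *\<^sub>v x))))
             \<le> Nhat * (x \<bullet> (A *\<^sub>v x))"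
    using assms unfolding pou_splitting_def by blast
  have RT: "(R s)\<^sup>T \<in> carrier_mat n (ns s)" if "s \<in> {1..N}" for s using R[OF that] by simp
  note D1 = spdD(1)[OF D]
  have F: "(R s)\<^sup>T * D s * R s \<in> carrier_mat n n" if "s \<in> {1..N}" for s
    by (rule mult_carrier_mat[OF mult_carrier_mat[OF RT[OF that] D1[OF that]] R[OF that]])
  have "\<exists>y. (\<forall>s\<in>{1..N}. y s \<in> carrier_vec (ns s)) \<and>
        x = vsum n (\<lambda>s. (R s)\<^sup>T *\<^sub>v y s) {1..N} \<and>
        (\<Sum>s=1..N. y s \<bullet> (M s *\<^sub>v y s)) \<le> Nhat * (x \<bullet> (A *\<^sub>v x))"
    if x: "x \<in> carrier_vec n" for x
  proof (intro exI conjI ballI)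
    have Rx: "R s *\<^sub>v x \<in> carrier_vec (ns s)" if "s \<in> {1..N}" for s
      by (rule mult_mat_vec_carrier[OF R[OF that] x])
    show y: "D s *\<^sub>v (R s *\<^sub>v x) \<in> carrier_vec (ns s)" if "s \<in> {1..N}" for s
      by (rule mult_mat_vec_carrier[OF D1[OF that] Rx[OF that]])
    have "x = 1\<^sub>m n *\<^sub>v x" using x by simp
    also have "\<dots> = vsum n (\<lambda>s. ((R s)\<^sup>T * D s * R s) *\<^sub>v x) {1..N}"
      unfolding one by (rule sum_mats_mult_vec[OF _ F x]) simp
    also have "\<dots> = vsum n (\<lambda>s. (R s)\<^sup>T *\<^sub>v (D s *\<^sub>v (R s *\<^sub>v x))) {1..N}"
    proof (rule vsum_cong)
      fix s assume s: "s \<in> {1..N}"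
      show "((R s)\<^sup>T * D s * R s) *\<^sub>v x = (R s)\<^sup>T *\<^sub>v (D s *\<^sub>v (R s *\<^sub>v x))"
        unfolding assoc_mult_mat_vec[OF mult_carrier_mat[OF RT[OF s] D1[OF s]] R[OF s] x]
        by (rule assoc_mult_mat_vec[OF RT[OF s] D1[OF s] Rx[OF s]])
      show "(R s)\<^sup>T *\<^sub>v (D s *\<^sub>v (R s *\<^sub>v x)) \<in> carrier_vec n"
        by (rule extend_carrier[OF s y[OF s]])
    qed simp
    finally show "x = vsum n (\<lambda>s. (R s)\<^sup>T *\<^sub>v (D s *\<^sub>v (R s *\<^sub>v x))) {1..N}" .
    show "(\<Sum>s=1..N. (D s *\<^sub>v (R s *\<^sub>v x)) \<bullet> (M s *\<^sub>v (D s *\<^sub>v (R s *\<^sub>v x))))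
             \<le> Nhat * (x \<bullet> (A *\<^sub>v x))" by (rule le[OF x])
  qed
  then show ?thesis unfolding splitting_def using M by blast
qed

text \<open>The good part of the first splitting is split again. Its low part \<open>l\<close> joins
  the coarse contribution. Its high part \<open>h\<close> gains the bound with \<upsilon> and keeps
  the one with \<tau>, because \<open>l\<close> and \<open>h\<close> are orthogonal for
  \<open>At s\<close>.\<close>

lemma double_geneo_split:
  assumes s: "s \<in> {1..N}" and RR: "R s * (R s)\<^sup>T = 1\<^sub>m (ns s)" and M: "spsd (ns s) (M s)"
    and \<tau>: "\<tau> > 0" and \<upsilon>: "\<upsilon> > 0"
    and cond: "geneo_condition (ns s) V0 \<tau> (R s) (At s) (M s)"
    and V: "(*\<^sub>v) ((R s)\<^sup>T) ` YL (ns s) \<upsilon> (At s) (R s * A * (R s)\<^sup>T) \<subseteq> V0"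
    and y: "y \<in> carrier_vec (ns s)"
  obtains g b where "g \<in> carrier_vec (ns s)" "b \<in> carrier_vec (ns s)" "y = g + b"
    "(R s)\<^sup>T *\<^sub>v b \<in> V0" "bil (At s) g g \<le> \<tau> * bil (M s) y y"
    "bil A ((R s)\<^sup>T *\<^sub>v g) ((R s)\<^sup>T *\<^sub>v g) \<le> inverse \<upsilon> * bil (At s) g g"
proof -
  note At1 = spdD(1)[OF At[OF s]] and Ats = spdD(2)[OF At[OF s]]
  have RT: "(R s)\<^sup>T \<in> carrier_mat n (ns s)" using R[OF s] by simp
  \<comment> \<open>Orthonormal rows make the transpose injective, so the right-hand matrix of the
    second pencil is spd.\<close>
  have inj: "w = 0\<^sub>v (ns s)" if "w \<in> carrier_vec (ns s)" "(R s)\<^sup>T *\<^sub>v w = 0\<^sub>v n" for w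
  proof -
    have "w = R s *\<^sub>v ((R s)\<^sup>T *\<^sub>v w)"
      using assoc_mult_mat_vec[OF R[OF s] RT that(1)] RR that(1) by simp
    also have "\<dots> = 0\<^sub>v (ns s)" unfolding that(2) using R[OF s] by (intro eq_vecI) auto
    finally show ?thesis .
  qed
  have spd: "spd (ns s) (R s * A * (R s)\<^sup>T)" using congruence_spd[OF A RT inj] by simp
  have cong: "bil (R s * A * (R s)\<^sup>T) w w = bil A ((R s)\<^sup>T *\<^sub>v w) ((R s)\<^sup>T *\<^sub>v w)"
    if "w \<in> carrier_vec (ns s)" for w
    using bil_congruence[OF RT A1 that that] by simp
  obtain g b where gb: "g \<in> carrier_vec (ns s)" "b \<in> carrier_vec (ns s)" "y = g + b"
    "(R s)\<^sup>T *\<^sub>v b \<in> V0" "bil (At s) g g \<le> \<tau> * bil (M s) y y"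
    by (rule geneo_split[OF At[OF s] M R[OF s] \<tau> cond y])
  obtain l h where lh: "l \<in> YL (ns s) \<upsilon> (At s) (R s * A * (R s)\<^sup>T)" "l \<in> carrier_vec (ns s)"
    "h \<in> carrier_vec (ns s)" "g = l + h" "bil (At s) l h = 0"
    "\<upsilon> * bil (R s * A * (R s)\<^sup>T) h h \<le> bil (At s) h h"
    using pencil_split[OF At1 Ats spd gb(1), of \<upsilon>] by metis
  have "bil (At s) g g = bil (At s) l l + bil (At s) h h"
    unfolding lh(4) using lh(2,3,5) At1 bil_sym[OF At1 Ats lh(2,3)]
    by (simp add: bil_add_left[of "At s" "ns s" "ns s"] bil_add_right[of "At s" "ns s" "ns s"])
  then have le: "bil (At s) h h \<le> \<tau> * bil (M s) y y"
    using spdD(4)[OF At[OF s] lh(2)] gb(5) by simp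
  have "bil A ((R s)\<^sup>T *\<^sub>v h) ((R s)\<^sup>T *\<^sub>v h) \<le> inverse \<upsilon> * bil (At s) h h"
    using lh(6) \<upsilon> unfolding cong[OF lh(3)] by (simp add: field_simps)
  moreover have "(R s)\<^sup>T *\<^sub>v (l + b) \<in> V0"
    unfolding mult_add_distrib_mat_vec[OF RT lh(2) gb(2)] using V lh(1) gb(4) by (intro V0(3)) auto
  moreover have "y = h + (l + b)" unfolding gb(3) lh(4) using lh(2,3) gb(2) by (intro eq_vecI) auto
  moreover have "l + b \<in> carrier_vec (ns s)" using lh(2) gb(2) by simp
  ultimately show ?thesis using that[of h "l + b"] lh(3) le by blast
qed

end

section \<open>Assembly of the three bounds\<close>

lemma mat_range_closed:
  assumes "B \<in> carrier_mat n k"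
  shows "mat_range B \<subseteq> carrier_vec n" "0\<^sub>v n \<in> mat_range B"
    "\<And>u v. u \<in> mat_range B \<Longrightarrow> v \<in> mat_range B \<Longrightarrow> u + v \<in> mat_range B"
proof -
  show "mat_range B \<subseteq> carrier_vec n" using assms unfolding mat_range_def by auto
  have "B *\<^sub>v 0\<^sub>v k = 0\<^sub>v n" using assms by (intro eq_vecI) auto
  then show "0\<^sub>v n \<in> mat_range B"
    unfolding mat_range_def using assms by (intro image_eqI[of _ _ "0\<^sub>v k"]) auto
  fix u v assume "u \<in> mat_range B" "v \<in> mat_range B"
  then obtain c d where cd: "c \<in> carrier_vec k" "d \<in> carrier_vec k" "u = B *\<^sub>v c" "v = B *\<^sub>v d"
    using assms unfolding mat_range_def by auto
  then have "u + v = B *\<^sub>v (c + d)" using mult_add_distrib_mat_vec[OF assms cd(1,2)] by simp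
  then show "u + v \<in> mat_range B"
    unfolding mat_range_def using assms cd(1,2) by (intro image_eqI[of _ _ "c + d"]) auto
qed

theorem theorem10:
  fixes n N Nc :: nat and ns :: "nat \<Rightarrow> nat"
    and A R0 :: "real mat" and R At :: "nat \<Rightarrow> real mat"
    and V0 :: "real vec set" and Csharp \<tau> \<upsilon> :: real
  assumes "spd n A"
    and "local_setting n N ns R At"
    and "coarse_setting n V0 R0"
    and "\<forall>s\<in>{1..N}. invertible_mat (At s)"
    and "coloring_constant N ns R A Nc"
    and "sharp_constant n N ns R At A Csharp"
    and "\<tau> > 0" and "\<upsilon> > 0"
  shows
    "(\<forall>lam. eigenvalue (two_level_additive n N R At A R0 * A) lam \<longrightarrow>
        lam \<le> real Nc * inverse Csharp + 1)
     \<and>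
     (\<forall>M Nhat.
        (splitting n N ns R A M Nhat \<or> pou_splitting n N ns R A M Nhat) \<and>
        (\<forall>s\<in>{1..N}. geneo_condition (ns s) V0 \<tau> (R s) (At s) (M s))
        \<longrightarrow>
        (\<forall>lam. eigenvalue (two_level_additive n N R At A R0 * A) lam \<longrightarrow>
           inverse (max 2 (1 + 2 * real Nc * inverse Csharp) * max 1 (Nhat * \<tau>)) \<le> lam))
     \<and>
     (\<forall>M Nhat.
        (splitting n N ns R A M Nhat \<or> pou_splitting n N ns R A M Nhat) \<and>
        (\<forall>s\<in>{1..N}.
           (*\<^sub>v) ((R s)\<^sup>T) ` YL (ns s) \<upsilon> (At s) (R s * A * (R s)\<^sup>T) \<subseteq> V0 \<and>
           geneo_condition (ns s) V0 \<tau> (R s) (At s) (M s))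
        \<longrightarrow>
        (\<forall>lam. eigenvalue (two_level_additive n N R At A R0 * A) lam \<longrightarrow>
           inverse (max 2 (1 + 2 * real Nc * inverse \<upsilon>) * max 1 (Nhat * \<tau>)) \<le> lam))"
proof -
  note A = assms(1) and sharp = assms(6) and col = assms(5)
  have R: "R s \<in> carrier_mat (ns s) n" and RR: "R s * (R s)\<^sup>T = 1\<^sub>m (ns s)"
    and At: "spd (ns s) (At s)" and inv: "invertible_mat (At s)" if "s \<in> {1..N}" for s
    using assms(2,4) that invertible_spsd_imp_spd unfolding local_setting_def by blast+
  obtain k where R0: "R0 \<in> carrier_mat k n" and V: "V0 = mat_range (R0\<^sup>T)"
    and inj: "\<And>c. c \<in> carrier_vec k \<Longrightarrow> R0\<^sup>T *\<^sub>v c = 0\<^sub>v n \<Longrightarrow> c = 0\<^sub>v k"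
    using coarse_settingD[OF assms(3)] by metis
  have RT: "R0\<^sup>T \<in> carrier_mat n k" using R0 by simp
  interpret schwarz n N ns A R At V0
    by (unfold_locales, rule A, rule R, assumption, rule At, assumption)
      (unfold V, rule mat_range_closed[OF RT], rule mat_range_closed[OF RT],
        rule mat_range_closed(3)[OF RT])
  have C: "Csharp > 0" using sharp unfolding sharp_constant_def by simp
  have sharp': "bil A ((R s)\<^sup>T *\<^sub>v x) ((R s)\<^sup>T *\<^sub>v x) \<le> inverse Csharp * bil (At s) x x"
    if "s \<in> {1..N}" "x \<in> carrier_vec (ns s)" for s x
    by (rule sharp_constant_nonsingular[where R = R and At = At and ns = ns, OF sharp A that(1) R[OF that(1)] At[OF that(1)] that(2)])
  have stable: "bil A (glue g) (glue g) \<le> real Nc * inverse Csharp * (\<Sum>s=1..N. bil (At s) (g s) (g s))"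
    if "local_family g" for g
    by (rule colored_stability[OF col that sharp'[OF _ local_familyD[OF that]]])
  have part1: "lam \<le> real Nc * inverse Csharp + 1"
    if ev: "eigenvalue (two_level_additive n N R At A R0 * A) lam" for lam
  proof -
    obtain x p z where e: "eigenpair lam x p z" by (rule eigenvalue_eigenpair[OF R0 V inj inv ev])
    show ?thesis by (rule eigenvalue_le[OF e _ stable]) (use C in auto)
  qed
  have part2: "inverse (max 2 (1 + 2 * real Nc * inverse Csharp) * max 1 (Nhat * \<tau>)) \<le> lam"
    if sp: "splitting n N ns R A M Nhat \<or> pou_splitting n N ns R A M Nhat"
      and ge: "\<forall>s\<in>{1..N}. geneo_condition (ns s) V0 \<tau> (R s) (At s) (M s)"
      and ev: "eigenvalue (two_level_additive n N R At A R0 * A) lam" for M Nhat lam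
  proof -
    obtain x p z where e: "eigenpair lam x p z" by (rule eigenvalue_eigenpair[OF R0 V inj inv ev])
    have sp': "splitting n N ns R A M Nhat" using sp pou_splitting_imp_splitting by blast
    \<comment> \<open>Here stability holds for every local family, so the trivial \<open>Q\<close>
      suffices. The stability constant is the product of \<open>Nc\<close> and
      \<open>inverse Csharp\<close>.\<close>
    have "inverse (max 2 (1 + 2 * (real Nc * inverse Csharp)) * max 1 (Nhat * \<tau>)) \<le> lam"
    proof (rule eigenvalue_ge_geneo[OF e assms(7) _ sp', where Q = "\<lambda>_ _. True"])
      fix s :: nat and y :: "real vec"
      assume s: "s \<in> {1..N}" and y: "y \<in> carrier_vec (ns s)"
      have M: "spsd (ns s) (M s)" using sp' s unfolding splitting_def by blast
      show "\<exists>g b. g \<in> carrier_vec (ns s) \<and> b \<in> carrier_vec (ns s) \<and> y = g + b \<and>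
          (R s)\<^sup>T *\<^sub>v b \<in> V0 \<and> bil (At s) g g \<le> \<tau> * bil (M s) y y \<and> True"
        by (rule geneo_split[OF At[OF s] M R[OF s] assms(7) bspec[OF ge s] y]) blast
    qed (use C stable in auto)
    then show ?thesis by (simp only: mult.assoc)
  qed
  have part3: "inverse (max 2 (1 + 2 * real Nc * inverse \<upsilon>) * max 1 (Nhat * \<tau>)) \<le> lam"
    if sp: "splitting n N ns R A M Nhat \<or> pou_splitting n N ns R A M Nhat"
      and ge: "\<forall>s\<in>{1..N}. (*\<^sub>v) ((R s)\<^sup>T) ` YL (ns s) \<upsilon> (At s) (R s * A * (R s)\<^sup>T) \<subseteq> V0 \<and>
           geneo_condition (ns s) V0 \<tau> (R s) (At s) (M s)"
      and ev: "eigenvalue (two_level_additive n N R At A R0 * A) lam" for M Nhat lam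
  proof -
    obtain x p z where e: "eigenpair lam x p z" by (rule eigenvalue_eigenpair[OF R0 V inj inv ev])
    have sp': "splitting n N ns R A M Nhat" using sp pou_splitting_imp_splitting by blast
    \<comment> \<open>The property \<open>Q\<close> now carries the local bound with
      \<open>inverse \<upsilon>\<close>, which takes the place of the one given by
      \<open>Csharp\<close>.\<close>
    have "inverse (max 2 (1 + 2 * (real Nc * inverse \<upsilon>)) * max 1 (Nhat * \<tau>)) \<le> lam"
    proof (rule eigenvalue_ge_geneo[OF e assms(7) _ sp', where
          Q = "\<lambda>s g. bil A ((R s)\<^sup>T *\<^sub>v g) ((R s)\<^sup>T *\<^sub>v g) \<le> inverse \<upsilon> * bil (At s) g g"])
      fix s :: nat and y :: "real vec"
      assume s: "s \<in> {1..N}" and y: "y \<in> carrier_vec (ns s)"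
      have M: "spsd (ns s) (M s)" using sp' s unfolding splitting_def by blast
      from bspec[OF ge s] have 1: "(*\<^sub>v) ((R s)\<^sup>T) ` YL (ns s) \<upsilon> (At s) (R s * A * (R s)\<^sup>T) \<subseteq> V0"
        and 2: "geneo_condition (ns s) V0 \<tau> (R s) (At s) (M s)" by blast+
      show "\<exists>g b. g \<in> carrier_vec (ns s) \<and> b \<in> carrier_vec (ns s) \<and> y = g + b \<and>
          (R s)\<^sup>T *\<^sub>v b \<in> V0 \<and> bil (At s) g g \<le> \<tau> * bil (M s) y y \<and>
          bil A ((R s)\<^sup>T *\<^sub>v g) ((R s)\<^sup>T *\<^sub>v g) \<le> inverse \<upsilon> * bil (At s) g g"
        by (rule double_geneo_split[where M = M, OF s RR[OF s] M assms(7,8) 2 1 y]) blast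
    next
      show "bil A (glue g) (glue g) \<le> real Nc * inverse \<upsilon> * (\<Sum>s=1..N. bil (At s) (g s) (g s))"
        if "local_family g" "\<And>s. s \<in> {1..N} \<Longrightarrow> bil A ((R s)\<^sup>T *\<^sub>v g s) ((R s)\<^sup>T *\<^sub>v g s)
          \<le> inverse \<upsilon> * bil (At s) (g s) (g s)" for g
        by (rule colored_stability[OF col that])
    qed (use assms(8) in auto)
    then show ?thesis by (simp only: mult.assoc)
  qed
  show ?thesis using part1 part2 part3 by blast
qed

end
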